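(* Let $n\ge 2$ be an integer, let $F:\mathbb{R}^n\to[0,\infty)$ be a strongly convex Finsler norm with polar $F_\circ$, let $\Omega\subset\mathbb{R}^n$ be a bounded domain that contains the origin, and let $R_\Omega:=\sup_{x\in\Omega}F_\circ(x)$. For any $F_\circ$-radially symmetric $u\in W^{1,n}_0(\Omega)$, $u\not\equiv0$, we have \[ \int_{\Omega}\exp\left(\bar\gamma\left[|u(x)|\,X_2^{1/n}\left(\frac{F_\circ(x)}{R_\Omega}\right)\right]^{\frac{n}{n-1}}\right)dx<+\infty, \qquad \bar\gamma:=n\left(\frac{4\,\omega_{n,F}}{n\,\kappa_n\,J_F[u]}\right)^{\frac1{n-1}}, \] where $\kappa_n:=\frac2n\left(\frac{n}{n-1}\right)^{n-2}$, $\omega_{n,F}:=\mathcal{H}^n(\{x\in\mathbb{R}^n: F_\circ(x)\le1\})$ and \[ J_F[u]:=\int_\Omega\left|\nabla u\cdot\frac{x}{F_\circ(x)}\right|^n|\nabla F_\circ(x)|\,dx-\left(\frac{n-1}{n}\right)^n\int_\Omega\frac{|u|^n}{F_\circ(x)^n}X_1^n\left(\frac{F_\circ(x)}{R_\Omega}\right)|\nabla F_\circ(x)|\,dx . \]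
   Context: A strongly convex Finsler norm is a function $F:\mathbb{R}^n\to[0,\infty)$ that is even, positively $1$-homogeneous, of class $C^2(\mathbb{R}^n\setminus\{0\})$, and such that the Hessian $\nabla^2(F^2)(\xi)$ is positive definite for every $\xi\ne0$. Its polar is $F_\circ(x):=\sup_{\xi\neq0}\frac{\xi\cdot x}{F(\xi)}$. Auxiliary functions: $X_1(t):=(1-\log t)^{-1}$ for $t\in(0,1]$, $X_1(0):=0$, and $X_2(t):=X_1(X_1(t))$. A function $u$ is $F_\circ$-radially symmetric (anisotropically radial) if $u(x)=\tilde u(F_\circ(x))$ for some function $\tilde u$ of one variable. $\mathcal{H}^n$ denotes the $n$-dimensional Hausdorff (i.e. Lebesgue) measure. *)

theory Defs
  imports "HOL-Analysis.Analysis"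
begin

subsection \<open>Classical differential calculus\<close>

definition partial :: "'n::finite \<Rightarrow> (real^'n \<Rightarrow> real) \<Rightarrow> real^'n \<Rightarrow> real" where
  "partial i f x = frechet_derivative f (at x) (axis i 1)"

definition grad :: "(real^'n::finite \<Rightarrow> real) \<Rightarrow> real^'n \<Rightarrow> real^'n" where
  "grad f x = (\<chi> i. partial i f x)"

definition hessian :: "(real^'n::finite \<Rightarrow> real) \<Rightarrow> real^'n \<Rightarrow> real^'n^'n" where
  "hessian f x = (\<chi> i j. partial i (partial j f) x)"

definition positive_definite :: "real^'n^'n \<Rightarrow> bool" where
  "positive_definite A \<longleftrightarrow> (\<forall>v. v \<noteq> 0 \<longrightarrow> v \<bullet> (A *v v) > 0)"

text \<open>\<open>Ck_on k S f\<close>: \<open>f\<close> is of class \<open>C\<^sup>k\<close> on \<open>S\<close>. It is meant for open \<open>S\<close> only.\<close>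

primrec Ck_on :: "nat \<Rightarrow> (real^'n::finite) set \<Rightarrow> (real^'n \<Rightarrow> real) \<Rightarrow> bool" where
  "Ck_on 0 S f \<longleftrightarrow> continuous_on S f"
| "Ck_on (Suc k) S f \<longleftrightarrow>
     (\<forall>x\<in>S. f differentiable (at x)) \<and> (\<forall>i. Ck_on k S (partial i f))"

definition test_functions :: "(real^'n::finite) set \<Rightarrow> (real^'n \<Rightarrow> real) set" where
  "test_functions \<Omega> = {\<phi>. (\<forall>k. Ck_on k UNIV \<phi>) \<and>
     compact (closure {x. \<phi> x \<noteq> 0}) \<and> closure {x. \<phi> x \<noteq> 0} \<subseteq> \<Omega>}"


subsection \<open>Sobolev spaces\<close>

text \<open>Elements of the spaces below are represented by functions, not by classes of functions
  modulo almost everywhere equality; only their values on \<open>\<Omega>\<close> matter.\<close>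

definition Lp_on :: "real \<Rightarrow> (real^'n::finite) set \<Rightarrow> (real^'n \<Rightarrow> 'b::euclidean_space) set" where
  "Lp_on p \<Omega> = {f. f \<in> borel_measurable (lebesgue_on \<Omega>) \<and>
     integrable (lebesgue_on \<Omega>) (\<lambda>x. norm (f x) powr p)}"

definition locally_integrable_on :: "(real^'n::finite \<Rightarrow> 'b::euclidean_space) \<Rightarrow> (real^'n) set \<Rightarrow> bool" where
  "locally_integrable_on f \<Omega> \<longleftrightarrow>
     (\<forall>K. compact K \<and> K \<subseteq> \<Omega> \<longrightarrow> f absolutely_integrable_on K)"

definition is_weak_grad ::
  "(real^'n::finite) set \<Rightarrow> (real^'n \<Rightarrow> real) \<Rightarrow> (real^'n \<Rightarrow> real^'n) \<Rightarrow> bool" where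
  "is_weak_grad \<Omega> u g \<longleftrightarrow> locally_integrable_on u \<Omega> \<and> locally_integrable_on g \<Omega> \<and>
     (\<forall>\<phi>\<in>test_functions \<Omega>. \<forall>i.
        (\<integral>x. u x * partial i \<phi> x \<partial>lebesgue_on \<Omega>) = - (\<integral>x. g x $ i * \<phi> x \<partial>lebesgue_on \<Omega>))"

text \<open>A weak gradient is unique only up to almost everywhere equality; this picks one
  representative.  It is used only under integrals.\<close>

definition weak_grad ::
  "(real^'n::finite) set \<Rightarrow> (real^'n \<Rightarrow> real) \<Rightarrow> real^'n \<Rightarrow> real^'n" where
  "weak_grad \<Omega> u = (SOME g. is_weak_grad \<Omega> u g)"

definition sobolev :: "real \<Rightarrow> (real^'n::finite) set \<Rightarrow> (real^'n \<Rightarrow> real) set" where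
  "sobolev p \<Omega> = {u. u \<in> Lp_on p \<Omega> \<and> (\<exists>g. is_weak_grad \<Omega> u g \<and> g \<in> Lp_on p \<Omega>)}"

definition sobolev_norm :: "real \<Rightarrow> (real^'n::finite) set \<Rightarrow> (real^'n \<Rightarrow> real) \<Rightarrow> real" where
  "sobolev_norm p \<Omega> u =
     ((\<integral>x. \<bar>u x\<bar> powr p \<partial>lebesgue_on \<Omega>) +
      (\<integral>x. norm (weak_grad \<Omega> u x) powr p \<partial>lebesgue_on \<Omega>)) powr (1 / p)"

text \<open>The closure of the test functions in \<open>sobolev p \<Omega>\<close>.\<close>

definition sobolev0 :: "real \<Rightarrow> (real^'n::finite) set \<Rightarrow> (real^'n \<Rightarrow> real) set" where
  "sobolev0 p \<Omega> = {u \<in> sobolev p \<Omega>. \<exists>\<phi>. (\<forall>k::nat. \<phi> k \<in> test_functions \<Omega>) \<and>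
     (\<lambda>k. sobolev_norm p \<Omega> (\<lambda>x. u x - \<phi> k x)) \<longlonglongrightarrow> 0}"


subsection \<open>Finsler norms\<close>

definition strongly_convex_finsler_norm :: "(real^'n::finite \<Rightarrow> real) \<Rightarrow> bool" where
  "strongly_convex_finsler_norm F \<longleftrightarrow>
     (\<forall>\<xi>. 0 \<le> F \<xi>) \<and>
     (\<forall>\<xi>. F (- \<xi>) = F \<xi>) \<and>
     (\<forall>t \<xi>. t > 0 \<longrightarrow> F (t *\<^sub>R \<xi>) = t * F \<xi>) \<and>
     Ck_on 2 (- {0}) F \<and>
     (\<forall>\<xi>. \<xi> \<noteq> 0 \<longrightarrow> positive_definite (hessian (\<lambda>\<eta>. (F \<eta>)\<^sup>2) \<xi>))"

definition polar :: "(real^'n::finite \<Rightarrow> real) \<Rightarrow> real^'n \<Rightarrow> real" where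
  "polar F x = (SUP \<xi>\<in>- {0}. (\<xi> \<bullet> x) / F \<xi>)"

definition finsler_radial_on ::
  "(real^'n::finite \<Rightarrow> real) \<Rightarrow> (real^'n) set \<Rightarrow> (real^'n \<Rightarrow> real) \<Rightarrow> bool" where
  "finsler_radial_on F \<Omega> u \<longleftrightarrow>
     (\<exists>v::real \<Rightarrow> real. AE x in lebesgue_on \<Omega>. u x = v (polar F x))"

definition R_dom :: "(real^'n::finite \<Rightarrow> real) \<Rightarrow> (real^'n) set \<Rightarrow> real" where
  "R_dom F \<Omega> = (SUP x\<in>\<Omega>. polar F x)"

definition omega_F :: "(real^'n::finite \<Rightarrow> real) \<Rightarrow> real" where
  "omega_F F = measure lebesgue {x. polar F x \<le> 1}"


subsection \<open>The functional and the constants\<close>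

text \<open>Only the values on \<open>[0, 1]\<close> matter.\<close>

definition X1 :: "real \<Rightarrow> real" where
  "X1 t = (if t = 0 then 0 else 1 / (1 - ln t))"

definition X2 :: "real \<Rightarrow> real" where
  "X2 t = X1 (X1 t)"

definition kappa :: "nat \<Rightarrow> real" where
  "kappa n = 2 / real n * (real n / (real n - 1)) ^ (n - 2)"

definition J_functional ::
  "(real^'n::finite \<Rightarrow> real) \<Rightarrow> (real^'n) set \<Rightarrow> (real^'n \<Rightarrow> real) \<Rightarrow> real" where
  "J_functional F \<Omega> u =
     (\<integral>x. \<bar>weak_grad \<Omega> u x \<bullet> (x /\<^sub>R polar F x)\<bar> ^ CARD('n) * norm (grad (polar F) x)
        \<partial>lebesgue_on \<Omega>)
     - ((real CARD('n) - 1) / real CARD('n)) ^ CARD('n) *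
       (\<integral>x. \<bar>u x\<bar> ^ CARD('n) / polar F x ^ CARD('n)
            * X1 (polar F x / R_dom F \<Omega>) ^ CARD('n) * norm (grad (polar F) x)
        \<partial>lebesgue_on \<Omega>)"

definition gamma_bar ::
  "(real^'n::finite \<Rightarrow> real) \<Rightarrow> (real^'n) set \<Rightarrow> (real^'n \<Rightarrow> real) \<Rightarrow> real" where
  "gamma_bar F \<Omega> u =
     real CARD('n) *
     (4 * omega_F F / (real CARD('n) * kappa CARD('n) * J_functional F \<Omega> u))
       powr (1 / (real CARD('n) - 1))"

end

(*
  Since u is fixed, gamma_bar is just some real number, and the weight X2 is at most 1 because
  polar F / R_dom lies in [0, 1].  So it suffices that exp (c |u|^(n/(n-1))) is integrable on Omega for
  every c >= 0 and every u in W_0^{1,n}(Omega), radial or not.  Writing u = phi_m + (u - phi_m) with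
  phi_m a test function and the gradient of u - phi_m small in L^n, this follows from Fatou's
  lemma and Trudinger's inequality for test functions.

  Trudinger's inequality is obtained by truncation.  On each line in a coordinate direction a
  function that reaches the level t + h crosses the slab {t < |psi| < t + h}, so the
  Gagliardo-Loomis-Whitney inequality bounds the measure of {|psi| >= t + h} by that of the
  slab as soon as the energy in the slab is at most h^n.  All slabs but a few have this property,
  hence the measures of the superlevel sets decay geometrically.
*)

theory Submission
  imports Defs "HOL-Computational_Algebra.Polynomial"
begin

section \<open>The Gagliardo-Loomis-Whitney inequality\<close>

text \<open>The comparison of a superlevel set with the slab below it has constant 1 only because
  the integrability exponent equals the dimension n: Hoelder's inequality in each of the n
  directions, multiplied together, puts the same power n (n - 1) on both measures. As the two sets
  are disjoint, crossing a slab of energy at most h^n halves the measure. If K is the total energy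
  and h^n = K / M, then 2 M slabs give the factor 2^(-M) at the level 2 M h = 2 K^(1/n) M^((n-1)/n);
  this is the origin of the exponent n / (n - 1). The coefficient in the resulting exponential bound
  is fixed only after division by K^(1/n). An arbitrary coefficient becomes available because the
  bound is applied to differences of approximating test functions, whose energy K is as small as
  desired, while the test function that is split off is bounded and costs a constant factor. The
  obstacle on the Sobolev side is that the norm refers to a weak gradient picked by choice.
  Smallness of that norm says something about actual gradients only after uniqueness of weak
  gradients is known, and this is what the smooth bumps are for.\<close>

lemma power_le_imp_le_ennreal:
  fixes a b :: ennreal
  assumes "a ^ m \<le> b ^ m" "m > 0"
  shows "a \<le> b"
proof (rule ccontr)
  assume "\<not> a \<le> b"
  then have ba: "b < a" by simp
  have bt: "b \<noteq> \<infinity>" using ba by auto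
  show False
  proof (cases "a = \<infinity>")
    case True
    then have "a ^ m = \<infinity>" using assms(2) by (simp add: top_power_ennreal)
    moreover have "b ^ m < \<infinity>" using bt by (simp add: power_less_top_ennreal top.not_eq_extremum)
    ultimately show False using assms(1) by auto
  next
    case False
    obtain x y where xy: "a = ennreal x" "b = ennreal y" "0 \<le> x" "0 \<le> y"
      using False bt by (metis ennreal_cases infinity_ennreal_def)
    have "y < x" using ba xy by (simp add: ennreal_less_iff)
    then have "y ^ m < x ^ m" using xy assms(2) by (simp add: power_strict_mono)
    then show False using assms(1) xy by (simp add: ennreal_power)
  qed
qed

text \<open>An infinite factor makes the sum infinite, so only finite families remain, where this is
  the real inequality between the means raised to the power \<open>card S\<close>. It is the
  pointwise ingredient of Hoelder's inequality.\<close>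

lemma arith_geom_mean_ennreal:
  fixes g :: "'i \<Rightarrow> ennreal"
  assumes "finite S" "S \<noteq> {}"
  shows "(\<Prod>i\<in>S. g i) \<le> ((\<Sum>i\<in>S. g i) / of_nat (card S)) ^ card S"
proof (cases "\<exists>i\<in>S. g i = \<infinity>")
  case True
  then have "(\<Sum>i\<in>S. g i) = \<infinity>" using assms(1) by (simp add: ennreal_sum_eq_top)
  moreover have "card S > 0" using assms by (simp add: card_gt_0_iff)
  ultimately show ?thesis
    by (simp add: ennreal_top_divide top_power_ennreal)
next
  case False
  define x where "x i = enn2real (g i)" for i
  have gx: "g i = ennreal (x i)" if "i \<in> S" for i
    using False that unfolding x_def by (simp add: less_top)
  have x0: "x i \<ge> 0" for i unfolding x_def by simp
  have c: "card S > 0" using assms by (simp add: card_gt_0_iff)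
  have "(\<Prod>i\<in>S. x i) = root (card S) (\<Prod>i\<in>S. x i) ^ card S"
    using c by (simp add: prod_nonneg x0)
  also have "\<dots> \<le> ((\<Sum>i\<in>S. x i) / card S) ^ card S"
    using arith_geom_mean[OF assms, of x] x0 c
    by (intro power_mono)
       (simp_all add: real_root_ge_zero prod_nonneg sum_divide_distrib root_powr_inverse)
  finally have *: "(\<Prod>i\<in>S. x i) \<le> ((\<Sum>i\<in>S. x i) / card S) ^ card S" .
  have "(\<Prod>i\<in>S. g i) = ennreal (\<Prod>i\<in>S. x i)" 
    using gx x0 by (simp add: prod_ennreal cong: prod.cong)
  moreover have "(\<Sum>i\<in>S. g i) = ennreal (\<Sum>i\<in>S. x i)"
    using gx x0 by (simp add: sum_ennreal cong: sum.cong)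
  ultimately show ?thesis using * c x0
    by (simp add: ennreal_of_nat_eq_real_of_nat divide_ennreal sum_nonneg ennreal_power)
qed

text \<open>Stated with powers instead of exponents \<open>1 / card S\<close>, so that no roots in \<^typ>\<open>ennreal\<close> are needed.\<close>

lemma nn_integral_Holder_prod:
  fixes g :: "'i \<Rightarrow> 'a \<Rightarrow> ennreal"
  assumes S: "finite S" "S \<noteq> {}"
    and H [measurable]: "h \<in> borel_measurable M"
    and G: "\<And>i. i \<in> S \<Longrightarrow> g i \<in> borel_measurable M"
    and le: "\<And>x. x \<in> space M \<Longrightarrow> h x ^ card S \<le> c * (\<Prod>i\<in>S. g i x)"
  shows "(\<integral>\<^sup>+x. h x \<partial>M) ^ card S \<le> c * (\<Prod>i\<in>S. \<integral>\<^sup>+x. g i x \<partial>M)"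
proof -
  define m where "m = card S"
  have m: "m > 0" using S unfolding m_def by (simp add: card_gt_0_iff)
  define I where "I i = (\<integral>\<^sup>+x. g i x \<partial>M)" for i
  \<comment> \<open>The factors are going to be divided by their integrals, which must therefore be
    neither 0 nor infinite. Vanishing integrals come first, so that in the case \<open>inf\<close>
    no product of 0 and infinity arises.\<close>
  consider (zero) i where "i \<in> S" "I i = 0" | (c0) "c = 0" 
    | (inf) "\<forall>i\<in>S. I i \<noteq> 0" "c \<noteq> 0" "c = \<infinity> \<or> (\<exists>i\<in>S. I i = \<infinity>)"
    | (fin) "\<forall>i\<in>S. I i \<noteq> 0 \<and> I i \<noteq> \<infinity>" "c \<noteq> 0" "c \<noteq> \<infinity>" by blast
  then have "(\<integral>\<^sup>+x. h x \<partial>M) ^ m \<le> c * (\<Prod>i\<in>S. I i)"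
  proof cases
    case zero
    have "AE x in M. g i x = 0"
      using zero nn_integral_0_iff_AE[OF G[OF zero(1)]] unfolding I_def by simp
    then have "AE x in M. h x = 0"
    proof (rule AE_mp, intro AE_I2 impI)
      fix x assume x: "x \<in> space M" "g i x = 0"
      have "(\<Prod>i\<in>S. g i x) = 0" using S(1) zero(1) x(2) by (intro prod_zero) auto
      then have "h x ^ card S \<le> 0"
        using le[OF x(1)] by (simp only: mult_zero_right)
      then show "h x = 0" by (simp add: power_eq_0_iff)
    qed
    then have "(\<integral>\<^sup>+x. h x \<partial>M) = 0" by (simp add: nn_integral_0_iff_AE)
    then show ?thesis using m by (simp add: power_0_left)
  next
    case c0
    then have "h x = 0" if "x \<in> space M" for x using le[OF that] by simp
    then have "(\<integral>\<^sup>+x. h x \<partial>M) = 0" by (simp cong: nn_integral_cong)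
    then show ?thesis using m by (simp add: power_0_left)
  next
    case inf
    then have "c * (\<Prod>i\<in>S. I i) = \<infinity>"
      using S(1) by (auto simp: ennreal_mult_eq_top_iff ennreal_prod_eq_top prod_zero_iff)
    then show ?thesis by simp
  next
    case fin
    \<comment> \<open>\<open>P\<close> is the root of the claimed bound. Factors divided by their
      integrals have integral 1, and so does their arithmetic mean \<open>q\<close>; the inequality
      between the means then yields \<open>h x \<le> P * q x\<close>, which only has to be
      integrated.\<close>
    define P where "P = root m (enn2real (c * (\<Prod>i\<in>S. I i)))"
    have ft: "c * (\<Prod>i\<in>S. I i) \<noteq> \<infinity>"
      using fin by (auto simp: ennreal_mult_eq_top_iff ennreal_prod_eq_top)
    have P0: "P \<ge> 0" unfolding P_def using m by simp
    have Pm: "ennreal P ^ m = c * (\<Prod>i\<in>S. I i)"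
      unfolding P_def using m ft by (simp add: ennreal_power less_top)
    define q where "q x = (\<Sum>i\<in>S. g i x / I i) / of_nat m" for x
    have hx: "h x \<le> ennreal P * q x" if x: "x \<in> space M" for x
    proof (rule power_le_imp_le_ennreal[OF _ m])
      have gi: "g i x = I i * (g i x / I i)" if "i \<in> S" for i
        using fin(1) that by (simp add: ennreal_times_divide mult.commute[of "I i"] ennreal_mult_divide_eq)
      have "h x ^ m \<le> c * (\<Prod>i\<in>S. g i x)" using le[OF x] unfolding m_def .
      also have "(\<Prod>i\<in>S. g i x) = (\<Prod>i\<in>S. I i * (g i x / I i))"
        by (rule prod.cong) (use gi in auto)
      also have "\<dots> = (\<Prod>i\<in>S. I i) * (\<Prod>i\<in>S. g i x / I i)" by (rule prod.distrib)
      also have "(\<Prod>i\<in>S. g i x / I i) \<le> q x ^ m"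
        unfolding q_def m_def by (rule arith_geom_mean_ennreal[OF S])
      finally show "h x ^ m \<le> (ennreal P * q x) ^ m"
        unfolding power_mult_distrib Pm by (simp add: mult.assoc mult_left_mono)
    qed
    have [measurable]: "q \<in> borel_measurable M"
      unfolding q_def using G by measurable
    have gI: "(\<integral>\<^sup>+x. g i x / I i \<partial>M) = 1" if "i \<in> S" for i
      using fin(1) that G[OF that]
      by (simp add: nn_integral_divide I_def[symmetric] ennreal_divide_self less_top)
    have "(\<integral>\<^sup>+x. q x \<partial>M) = (\<Sum>i\<in>S. (\<integral>\<^sup>+x. g i x / I i \<partial>M)) / of_nat m"
      unfolding q_def using G
      by (subst nn_integral_divide) (auto simp: nn_integral_sum)
    also have "\<dots> = 1"
      using m by (simp add: gI m_def ennreal_of_nat_eq_real_of_nat divide_ennreal)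
    finally have q1: "(\<integral>\<^sup>+x. q x \<partial>M) = 1" .
    have "(\<integral>\<^sup>+x. h x \<partial>M) \<le> (\<integral>\<^sup>+x. ennreal P * q x \<partial>M)"
      by (rule nn_integral_mono) (rule hx)
    also have "\<dots> = ennreal P" by (simp add: nn_integral_cmult q1)
    finally have "(\<integral>\<^sup>+x. h x \<partial>M) ^ m \<le> ennreal P ^ m" by (rule power_mono) simp
    then show ?thesis unfolding Pm .
  qed
  then show ?thesis unfolding m_def I_def .
qed

section \<open>Integrating out a set of coordinates\<close>

interpretation lborel_product: product_sigma_finite "\<lambda>_. lborel :: real measure"
  by (rule product_sigma_finite.intro) (rule lborel.sigma_finite_measure_axioms)

text \<open>The integral of f over the affine subspace through x spanned by J. Keeping the whole
  point x as argument, although the value does not change along J, avoids splitting the space into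
  complementary coordinate blocks.\<close>

definition marg :: "'a set \<Rightarrow> ('a \<Rightarrow> ennreal) \<Rightarrow> 'a::euclidean_space \<Rightarrow> ennreal" where
  "marg J f x = (\<integral>\<^sup>+ y. f (x + (\<Sum>b\<in>J. y b *\<^sub>R b)) \<partial>(\<Pi>\<^sub>M b\<in>J. lborel))"

lemma marg_empty [simp]: "marg {} f x = f x"
  by (simp add: marg_def PiM_empty nn_integral_count_space_finite)

context
  fixes f :: "'a::euclidean_space \<Rightarrow> ennreal"
  assumes f [measurable]: "f \<in> borel_measurable borel"
begin

lemma borel_measurable_marg [measurable]:
  assumes J: "finite J"
  shows "marg J f \<in> borel_measurable borel"
proof -
  interpret sigma_finite_measure "\<Pi>\<^sub>M b\<in>J. lborel :: real measure"
    using J by (rule lborel_product.sigma_finite)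
  show ?thesis unfolding marg_def by measurable
qed

text \<open>Tonelli's theorem for one further coordinate; k has to be new so that updating y at k
  leaves the sum over J unchanged.\<close>

lemma marg_insert:
  assumes "finite J" and k: "k \<notin> J"
  shows "marg (insert k J) f x = (\<integral>\<^sup>+ s. marg J f (x + s *\<^sub>R k) \<partial>lborel)"
proof -
  have upd: "(\<Sum>b\<in>insert k J. (y(k := s)) b *\<^sub>R b) = s *\<^sub>R k + (\<Sum>b\<in>J. y b *\<^sub>R b)" for y s
  proof -
    have "(\<Sum>b\<in>J. (y(k := s)) b *\<^sub>R b) = (\<Sum>b\<in>J. y b *\<^sub>R b)"
      using k by (intro sum.cong) auto
    then show ?thesis using assms by simp
  qed
  have "marg (insert k J) f x =
    (\<integral>\<^sup>+ s. \<integral>\<^sup>+ y. f (x + (\<Sum>b\<in>insert k J. (y(k := s)) b *\<^sub>R b)) \<partial>(\<Pi>\<^sub>M b\<in>J. lborel) \<partial>lborel)"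
    unfolding marg_def using assms
    by (intro lborel_product.product_nn_integral_insert_rev) (simp_all, measurable)
  also have "\<dots> = (\<integral>\<^sup>+ s. marg J f (x + s *\<^sub>R k) \<partial>lborel)"
    by (simp only: marg_def add.assoc upd)
  finally show ?thesis .
qed

text \<open>Moving x along k merely shifts the integration variable belonging to k, and Lebesgue
  measure on the line is translation invariant.\<close>

lemma marg_const:
  assumes J: "finite J" and k: "k \<in> J"
  shows "marg J f (x + s *\<^sub>R k) = marg J f x"
proof -
  have *: "marg J f z = (\<integral>\<^sup>+ r. marg (J - {k}) f (z + r *\<^sub>R k) \<partial>lborel)" for z
    using marg_insert[of "J - {k}" k z] J k by (simp add: insert_absorb)
  have [measurable]: "marg (J - {k}) f \<in> borel_measurable borel"
    using J by (intro borel_measurable_marg) simp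
  have "marg J f (x + s *\<^sub>R k) = (\<integral>\<^sup>+ r. marg (J - {k}) f (x + (s + 1 * r) *\<^sub>R k) \<partial>lborel)"
    by (simp add: * scaleR_add_left add.assoc)
  also have "\<dots> = (\<integral>\<^sup>+ r. marg (J - {k}) f (x + r *\<^sub>R k) \<partial>lborel)"
    by (subst (2) nn_integral_real_affine[where t=s and c=1]) auto
  also have "\<dots> = marg J f x" by (simp add: *)
  finally show ?thesis .
qed

lemma marg_Basis: "marg Basis f x = (\<integral>\<^sup>+ y. f y \<partial>lborel)"
proof -
  have "(\<integral>\<^sup>+ y. f y \<partial>lborel) = (\<integral>\<^sup>+ y. f (x + y) \<partial>lborel)"
    by (subst lborel_distr_plus[of x, symmetric], subst nn_integral_distr) auto
  also have "\<dots> = marg Basis f x"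
    unfolding marg_def by (subst lborel_eq, subst nn_integral_distr) auto
  finally show ?thesis ..
qed

end

text \<open>Gagliardo's induction, integrating out one coordinate \<open>k\<close> at a time: the factor of index \<open>k\<close>
  does not depend on that coordinate, which leaves \<open>DIM('a) - 1\<close> factors for Hoelder's inequality.\<close>

lemma marg_power_le:
  fixes h :: "'a::euclidean_space \<Rightarrow> ennreal" and g :: "'a \<Rightarrow> 'a \<Rightarrow> ennreal"
  assumes dim: "DIM('a) \<ge> 2"
    and h [measurable]: "h \<in> borel_measurable borel"
    and g [measurable]: "\<And>b. b \<in> Basis \<Longrightarrow> g b \<in> borel_measurable borel"
    and le: "\<And>x. h x ^ (DIM('a) - 1) \<le> (\<Prod>b\<in>Basis. marg {b} (g b) x)"
    and "J \<subseteq> Basis"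
  shows "marg J h x ^ (DIM('a) - 1) \<le> (\<Prod>b\<in>Basis. marg (insert b J) (g b) x)"
proof -
  have "finite J" using \<open>J \<subseteq> Basis\<close> finite_Basis by (rule finite_subset)
  then show ?thesis using \<open>J \<subseteq> Basis\<close>
  proof (induction J arbitrary: x rule: finite_induct)
    case empty
    then show ?case using le by simp
  next
    case (insert k J)
    let ?S = "Basis - {k} :: 'a set"
    have k: "k \<in> Basis" using insert by simp
    have card: "card ?S = DIM('a) - 1" using k by simp
    have "?S \<noteq> {}" using card dim by (metis One_nat_def card.empty diff_is_0_eq not_less_eq_eq numeral_2_eq_2)
    have fin: "finite (insert b J)" for b using insert by simp
    have split: "(\<Prod>b\<in>Basis. F b) = F k * (\<Prod>b\<in>?S. F b)" for F :: "'a \<Rightarrow> ennreal"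
      using k by (simp add: prod.remove)
    have "(\<integral>\<^sup>+ s. marg J h (x + s *\<^sub>R k) \<partial>lborel) ^ card ?S
       \<le> marg (insert k J) (g k) x *
         (\<Prod>b\<in>?S. \<integral>\<^sup>+ s. marg (insert b J) (g b) (x + s *\<^sub>R k) \<partial>lborel)"
    proof (rule nn_integral_Holder_prod)
      show "finite ?S" by simp
      show "?S \<noteq> {}" by fact
      show "(\<lambda>s. marg J h (x + s *\<^sub>R k)) \<in> borel_measurable lborel"
        using borel_measurable_marg[OF h insert(1)] by measurable
      show "(\<lambda>s. marg (insert b J) (g b) (x + s *\<^sub>R k)) \<in> borel_measurable lborel" if "b \<in> ?S" for b
      proof -
        have "marg (insert b J) (g b) \<in> borel_measurable borel"
          using that fin by (intro borel_measurable_marg g) auto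
        then show ?thesis by measurable
      qed
      show "marg J h (x + s *\<^sub>R k) ^ card ?S
        \<le> marg (insert k J) (g k) x * (\<Prod>b\<in>?S. marg (insert b J) (g b) (x + s *\<^sub>R k))" for s
        using insert.IH[of "x + s *\<^sub>R k"] insert.prems
        by (simp add: card split marg_const[OF g[OF k] fin])
    qed
    also have "(\<integral>\<^sup>+ s. marg J h (x + s *\<^sub>R k) \<partial>lborel) = marg (insert k J) h x"
      using insert by (simp add: marg_insert[OF h])
    also have "(\<Prod>b\<in>?S. \<integral>\<^sup>+ s. marg (insert b J) (g b) (x + s *\<^sub>R k) \<partial>lborel)
       = (\<Prod>b\<in>?S. marg (insert b (insert k J)) (g b) x)"
    proof (rule prod.cong[OF refl])
      fix b assume b: "b \<in> ?S"
      have "(\<integral>\<^sup>+ s. marg (insert b J) (g b) (x + s *\<^sub>R k) \<partial>lborel) = marg (insert k (insert b J)) (g b) x"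
        using b insert.hyps fin by (subst marg_insert[OF g]) auto
      then show "(\<integral>\<^sup>+ s. marg (insert b J) (g b) (x + s *\<^sub>R k) \<partial>lborel) = marg (insert b (insert k J)) (g b) x"
        by (simp add: insert_commute)
    qed
    finally show ?case by (simp add: card split)
  qed
qed

text \<open>The end of the induction: for \<open>J = Basis\<close> every marginal is a full
  integral, and 0 is just some base point. In the classical form the factor of index b is a function
  of the other coordinates; here it is the line integral of \<open>g b\<close> in direction b, whose
  integral over those coordinates is the integral of \<open>g b\<close>.\<close>

theorem Gagliardo_Loomis_Whitney:
  fixes h :: "'a::euclidean_space \<Rightarrow> ennreal" and g :: "'a \<Rightarrow> 'a \<Rightarrow> ennreal"
  assumes dim: "DIM('a) \<ge> 2"
    and h [measurable]: "h \<in> borel_measurable borel"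
    and g [measurable]: "\<And>b. b \<in> Basis \<Longrightarrow> g b \<in> borel_measurable borel"
    and le: "\<And>x. h x ^ (DIM('a) - 1) \<le> (\<Prod>b\<in>Basis. \<integral>\<^sup>+ s. g b (x + s *\<^sub>R b) \<partial>lborel)"
  shows "(\<integral>\<^sup>+ x. h x \<partial>lborel) ^ (DIM('a) - 1) \<le> (\<Prod>b\<in>Basis. \<integral>\<^sup>+ x. g b x \<partial>lborel)"
proof -
  have "marg {b} (g b) x = (\<integral>\<^sup>+ s. g b (x + s *\<^sub>R b) \<partial>lborel)" if "b \<in> Basis" for b x
    using that by (simp add: marg_insert[OF g])
  then have "marg Basis h 0 ^ (DIM('a) - 1) \<le> (\<Prod>b\<in>Basis. marg (insert b Basis) (g b) 0)"
    using le by (intro marg_power_le[OF dim h g]) (simp_all cong: prod.cong)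
  also have "(\<Prod>b\<in>Basis. marg (insert b Basis) (g b) 0) = (\<Prod>b\<in>Basis. \<integral>\<^sup>+ x. g b x \<partial>lborel)"
    by (intro prod.cong) (simp_all add: insert_absorb marg_Basis[OF g])
  finally show ?thesis by (simp add: marg_Basis[OF h])
qed

section \<open>Trudinger's inequality by truncation\<close>

text \<open>Let p be the last point of the interval where w is at least t + h, and c the first point
  after p where w is at most t. Strictly between them w stays inside the slab, while the fundamental
  theorem of calculus makes the integral of \<bar>w'\<bar> over this piece at least h.\<close>

lemma slab_crossing_aux:
  fixes w w' :: "real \<Rightarrow> real"
  assumes der: "\<And>s. (w has_real_derivative w' s) (at s)"
    and cont: "continuous_on UNIV w'"
    and ab: "a \<le> b" "w a \<ge> t + h" "w b \<le> t" and h: "h > 0"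
  shows "ennreal h \<le> (\<integral>\<^sup>+ s. indicator {s. t < w s \<and> w s < t + h} s * ennreal \<bar>w' s\<bar> \<partial>lborel)"
proof -
  have cw: "continuous_on A w" for A
    using der by (meson DERIV_isCont continuous_at_imp_continuous_on)
  have comp: "compact {s\<in>{x..y}. w s \<in> C}" if "closed C" for x y C
  proof -
    have "{s\<in>{x..y}. w s \<in> C} = {x..y} \<inter> w -` C" by auto
    moreover have "closed ({x..y} \<inter> w -` C)"
      using that by (intro continuous_closed_preimage cw closed_atLeastAtMost)
    ultimately show ?thesis
      by (metis Int_lower1 bounded_closed_interval bounded_subset compact_eq_bounded_closed)
  qed
  have "compact {s\<in>{a..b}. w s \<ge> t + h}" using comp[of "{t+h..}" a b] by simp
  then obtain p where p: "p \<in> {a..b}" "w p \<ge> t + h" 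
    "\<And>s. s \<in> {a..b} \<Longrightarrow> w s \<ge> t + h \<Longrightarrow> s \<le> p"
    using compact_attains_sup[of "{s\<in>{a..b}. w s \<ge> t + h}"] ab by auto
  have "compact {s\<in>{p..b}. w s \<le> t}" using comp[of "{..t}" p b] by simp
  then obtain c where c: "c \<in> {p..b}" "w c \<le> t"
    "\<And>s. s \<in> {p..b} \<Longrightarrow> w s \<le> t \<Longrightarrow> c \<le> s"
    using compact_attains_inf[of "{s\<in>{p..b}. w s \<le> t}"] ab p by auto
  have pc: "p \<le> c" using c by simp
  have [measurable]: "w' \<in> borel_measurable borel" "w \<in> borel_measurable borel"
    using cont cw by (auto intro: borel_measurable_continuous_onI)
  have isc: "isCont w' x" for x using cont by (simp add: continuous_on_eq_continuous_at)
  have FTC: "has_bochner_integral lborel (\<lambda>x. w' x * indicator {p..c} x) (w c - w p)"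
    using pc der isc by (intro has_bochner_integral_FTC_Icc_real) auto
  have "ennreal h \<le> ennreal \<bar>w c - w p\<bar>" using p c by (intro ennreal_leI) simp
  also have "\<dots> = ennreal (norm (\<integral>x. w' x * indicator {p..c} x \<partial>lborel))"
    using FTC by (simp add: has_bochner_integral_iff)
  also have "\<dots> \<le> (\<integral>\<^sup>+ x. ennreal (norm (w' x * indicator {p..c} x)) \<partial>lborel)"
    using FTC by (intro integral_norm_bound_ennreal) (simp add: has_bochner_integral_iff)
  also have "\<dots> \<le> (\<integral>\<^sup>+ s. indicator {s. t < w s \<and> w s < t + h} s * ennreal \<bar>w' s\<bar> \<partial>lborel)"
  proof (rule nn_integral_mono_AE)
    \<comment> \<open>The open slab does not contain the values at p and c, so the pointwise
      comparison is made off these two points.\<close>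
    have "AE x in lborel. x \<noteq> p \<and> x \<noteq> c"
      using AE_lborel_singleton[of p] AE_lborel_singleton[of c] by eventually_elim simp
    then show "AE x in lborel. ennreal (norm (w' x * indicator {p..c} x))
        \<le> indicator {s. t < w s \<and> w s < t + h} x * ennreal \<bar>w' x\<bar>"
    proof eventually_elim
      case (elim x)
      show ?case
      proof (cases "x \<in> {p..c}")
        case True
        then have "w x < t + h" "t < w x"
          using p(3)[of x] c(3)[of x] elim p(1) c(1) by force+
        then show ?thesis using True by (simp add: abs_mult)
      qed simp
    qed
  qed
  finally show ?thesis .
qed

text \<open>Sign changes reduce everything to a descent from left to right. A negative value at a is
  handled by negating w. If b lies to the left of a, the negated function descends from b to a
  through the slab between -(t + h) and -t, so the auxiliary lemma is applied at the level -(t +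
  h).\<close>

lemma slab_crossing:
  fixes w w' :: "real \<Rightarrow> real"
  assumes der: "\<And>s. (w has_real_derivative w' s) (at s)"
    and cont: "continuous_on UNIV w'"
    and ab: "\<bar>w a\<bar> \<ge> t + h" "w b = 0" and h: "h > 0" and t: "t \<ge> 0"
  shows "ennreal h \<le> (\<integral>\<^sup>+ s. indicator {s. t < \<bar>w s\<bar> \<and> \<bar>w s\<bar> < t + h} s * ennreal \<bar>w' s\<bar> \<partial>lborel)"
proof -
  have *: "ennreal h \<le> (\<integral>\<^sup>+ s. indicator {s. t < \<bar>v s\<bar> \<and> \<bar>v s\<bar> < t + h} s * ennreal \<bar>v' s\<bar> \<partial>lborel)"
    if v: "\<And>s. (v has_real_derivative v' s) (at s)" "continuous_on UNIV v'" "v a \<ge> t + h" "v b = 0" for v v'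
  proof -
    have "ennreal h \<le> (\<integral>\<^sup>+ s. indicator {s. t < v s \<and> v s < t + h} s * ennreal \<bar>v' s\<bar> \<partial>lborel)"
    proof (cases "a \<le> b")
      case True
      then show ?thesis using slab_crossing_aux[of v v' a b t h] v h t by simp
    next
      case False
      have "((\<lambda>s. - v s) has_real_derivative - v' s) (at s)" for s
        by (intro derivative_intros v)
      moreover have "continuous_on UNIV (\<lambda>s. - v' s)" by (intro continuous_intros v)
      ultimately have "ennreal h \<le> (\<integral>\<^sup>+ s. indicator {s. - (t + h) < - v s \<and> - v s < - (t + h) + h} s * ennreal \<bar>- v' s\<bar> \<partial>lborel)"
        using False v h t by (intro slab_crossing_aux[of _ _ b a]) auto
      also have "{s. - (t + h) < - v s \<and> - v s < - (t + h) + h} = {s. t < v s \<and> v s < t + h}" by auto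
      finally show ?thesis by simp
    qed
    also have "\<dots> \<le> (\<integral>\<^sup>+ s. indicator {s. t < \<bar>v s\<bar> \<and> \<bar>v s\<bar> < t + h} s * ennreal \<bar>v' s\<bar> \<partial>lborel)"
      using t by (intro nn_integral_mono) (auto simp: indicator_def)
    finally show ?thesis .
  qed
  show ?thesis
  proof (cases "w a \<ge> 0")
    case True
    then show ?thesis using *[OF der cont] ab by simp
  next
    case False
    have "((\<lambda>s. - w s) has_real_derivative - w' s) (at s)" for s
      by (intro derivative_intros der)
    moreover have "continuous_on UNIV (\<lambda>s. - w' s)" by (intro continuous_intros cont)
    ultimately show ?thesis using *[of "\<lambda>s. - w s" "\<lambda>s. - w' s"] False ab by simp
  qed
qed

text \<open>Let A be the superlevel set and S the slab. The function \<open>g b\<close>, which is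
  \<bar>D b\<bar> / h cut off to S, has integral at least 1 on each line in direction b through a
  point of A, so the indicator of A is admissible in the Gagliardo-Loomis-Whitney inequality.
  Hoelder's inequality and the energy bound control the integral of \<open>g b\<close> by the
  measure of S.\<close>

lemma emeasure_superlevel_le_slab:
  fixes \<psi> :: "'a::euclidean_space \<Rightarrow> real" and D :: "'a \<Rightarrow> 'a \<Rightarrow> real"
  assumes dim: "DIM('a) \<ge> 2"
    and der: "\<And>b x s. b \<in> Basis \<Longrightarrow> ((\<lambda>s. \<psi> (x + s *\<^sub>R b)) has_real_derivative D b (x + s *\<^sub>R b)) (at s)"
    and contD: "\<And>b. b \<in> Basis \<Longrightarrow> continuous_on UNIV (D b)"
    and cont: "continuous_on UNIV \<psi>"
    and supp: "bounded {x. \<psi> x \<noteq> 0}"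
    and t: "t \<ge> 0" and h: "h > 0"
    and E: "\<And>b. b \<in> Basis \<Longrightarrow> 
      (\<integral>\<^sup>+ x. indicator {x. t < \<bar>\<psi> x\<bar> \<and> \<bar>\<psi> x\<bar> < t + h} x * ennreal (\<bar>D b x\<bar> ^ DIM('a)) \<partial>lborel) \<le> ennreal (h ^ DIM('a))"
  shows "emeasure lborel {x. t + h \<le> \<bar>\<psi> x\<bar>} \<le> emeasure lborel {x. t < \<bar>\<psi> x\<bar> \<and> \<bar>\<psi> x\<bar> < t + h}"
proof -
  define n where "n = DIM('a)"
  have n: "n \<ge> 2" using dim unfolding n_def .
  define S where "S = {x. t < \<bar>\<psi> x\<bar> \<and> \<bar>\<psi> x\<bar> < t + h}"
  define A where "A = {x. t + h \<le> \<bar>\<psi> x\<bar>}"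
  define g where "g b x = indicator S x * ennreal (\<bar>D b x\<bar> / h)" for b x
  have [measurable]: "\<psi> \<in> borel_measurable borel"
    using cont by (rule borel_measurable_continuous_onI)
  have mD [measurable]: "D b \<in> borel_measurable borel" if "b \<in> Basis" for b
    using contD[OF that] by (rule borel_measurable_continuous_onI)
  have [measurable]: "S \<in> sets borel" "A \<in> sets borel" unfolding S_def A_def by measurable
  have mg [measurable]: "g b \<in> borel_measurable borel" if [simp]: "b \<in> Basis" for b
    unfolding g_def by measurable
  have line: "1 \<le> (\<integral>\<^sup>+ s. g b (x + s *\<^sub>R b) \<partial>lborel)" if b: "b \<in> Basis" and x: "x \<in> A" for b x
  proof -
    obtain r where r: "\<And>y. \<psi> y \<noteq> 0 \<Longrightarrow> norm y \<le> r"
      using supp by (auto simp: bounded_iff)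
    \<comment> \<open>A parameter beyond the support: basis vectors have norm 1, so the point
      reached has norm greater than r, and \<psi> vanishes there. This is the second end of the
      crossing.\<close>
    define q where "q = \<bar>r\<bar> + norm x + 1"
    have "norm (q *\<^sub>R b) \<le> norm (x + q *\<^sub>R b) + norm x" by (metis add_diff_cancel_left' norm_triangle_ineq4)
    then have "norm (x + q *\<^sub>R b) > r" using b unfolding q_def by simp
    then have q: "\<psi> (x + q *\<^sub>R b) = 0" using r by force
    have cl: "continuous_on UNIV (\<lambda>s. D b (x + s *\<^sub>R b))"
      by (rule continuous_on_compose2[OF contD[OF b]]) (auto intro!: continuous_intros)
    have "ennreal h \<le> (\<integral>\<^sup>+ s. indicator {s. t < \<bar>\<psi> (x + s *\<^sub>R b)\<bar> \<and> \<bar>\<psi> (x + s *\<^sub>R b)\<bar> < t + h} s * ennreal \<bar>D b (x + s *\<^sub>R b)\<bar> \<partial>lborel)"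
      using slab_crossing[of "\<lambda>s. \<psi> (x + s *\<^sub>R b)" "\<lambda>s. D b (x + s *\<^sub>R b)" t h 0 q] der[OF b] cl q h t x
      by (simp add: A_def)
    also have "\<dots> = (\<integral>\<^sup>+ s. ennreal h * g b (x + s *\<^sub>R b) \<partial>lborel)"
      using h by (intro nn_integral_cong) (auto simp: g_def S_def indicator_def ennreal_mult'[symmetric])
    also have "\<dots> = ennreal h * (\<integral>\<^sup>+ s. g b (x + s *\<^sub>R b) \<partial>lborel)"
      using b by (intro nn_integral_cmult) measurable
    finally have "ennreal h * 1 \<le> ennreal h * (\<integral>\<^sup>+ s. g b (x + s *\<^sub>R b) \<partial>lborel)" by simp
    then show ?thesis using h by (subst (asm) ennreal_mult_le_mult_iff) auto
  qed
  have "(\<integral>\<^sup>+ x. indicator A x \<partial>lborel) ^ (DIM('a) - 1) \<le> (\<Prod>b\<in>Basis. \<integral>\<^sup>+ x. g b x \<partial>lborel)"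
  proof (rule Gagliardo_Loomis_Whitney[OF dim])
    show "indicator A x ^ (DIM('a) - 1) \<le> (\<Prod>b\<in>Basis. \<integral>\<^sup>+ s. g b (x + s *\<^sub>R b) \<partial>lborel)" for x
    proof (cases "x \<in> A")
      case True
      have "(\<Prod>b\<in>(Basis::'a set). (1::ennreal)) \<le> (\<Prod>b\<in>(Basis::'a set). \<integral>\<^sup>+ s. g b (x + s *\<^sub>R b) \<partial>lborel)"
        using line True by (intro prod_mono_ennreal) auto
      then show ?thesis using True by simp
    qed (use dim in \<open>simp add: power_0_left\<close>)
  qed auto
  then have LW: "emeasure lborel A ^ (n - 1) \<le> (\<Prod>b\<in>Basis. \<integral>\<^sup>+ x. g b x \<partial>lborel)"
    by (simp add: n_def)
  have Ho: "(\<integral>\<^sup>+ x. g b x \<partial>lborel) ^ n \<le> emeasure lborel S ^ (n - 1)" if b: "b \<in> Basis" for b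
  proof -
    \<comment> \<open>One factor carries the energy divided by h^n, with integral at most 1; the
      other n - 1 factors are indicators of the slab. Their product is the n-th power of
      \<open>g b\<close>.\<close>
    define G where "G c x = (if c = b then indicator S x * ennreal (\<bar>D b x\<bar> ^ n / h ^ n) else indicator S x)" for c x
    have split: "(\<Prod>c\<in>Basis. F c) = F b * (\<Prod>c\<in>Basis - {b}. F c)" for F :: "'a \<Rightarrow> ennreal"
      using b by (simp add: prod.remove)
    have "(\<integral>\<^sup>+ x. G b x \<partial>lborel) = (\<integral>\<^sup>+ x. ennreal (1 / h ^ n) * (indicator S x * ennreal (\<bar>D b x\<bar> ^ n)) \<partial>lborel)"
      using h by (intro nn_integral_cong) (auto simp: G_def indicator_def ennreal_mult'[symmetric])
    also have "\<dots> = ennreal (1 / h ^ n) * (\<integral>\<^sup>+ x. indicator S x * ennreal (\<bar>D b x\<bar> ^ n) \<partial>lborel)"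
      using b by (intro nn_integral_cmult) measurable
    also have "\<dots> \<le> ennreal (1 / h ^ n) * ennreal (h ^ n)"
      using E[OF b] by (intro mult_left_mono) (auto simp: S_def n_def)
    also have "\<dots> = 1" using h by (simp add: ennreal_mult'[symmetric])
    finally have Gb: "(\<integral>\<^sup>+ x. G b x \<partial>lborel) \<le> 1" .
    have "(\<integral>\<^sup>+ x. g b x \<partial>lborel) ^ card (Basis::'a set) \<le> 1 * (\<Prod>c\<in>Basis. \<integral>\<^sup>+ x. G c x \<partial>lborel)"
    proof (rule nn_integral_Holder_prod)
      show "G c \<in> borel_measurable lborel" for c
        unfolding G_def using b by (cases "c = b") auto
      show "g b x ^ card (Basis::'a set) \<le> 1 * (\<Prod>c\<in>Basis. G c x)" for x
      proof -
        have "(\<Prod>c\<in>Basis. G c x) = G b x * (\<Prod>c\<in>Basis - {b}. indicator S x)"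
          unfolding split by (intro arg_cong2[where f="(*)"] prod.cong) (auto simp: G_def)
        then show ?thesis using h n
          by (cases "x \<in> S") (simp_all add: G_def g_def n_def[symmetric] power_0_left ennreal_power power_divide)
      qed
    qed (use b in \<open>auto\<close>)
    also have "\<dots> = (\<integral>\<^sup>+ x. G b x \<partial>lborel) * (\<Prod>c\<in>Basis - {b}. emeasure lborel S)"
    proof -
      have "(\<integral>\<^sup>+ x. G c x \<partial>lborel) = emeasure lborel S" if "c \<noteq> b" for c
        using that by (simp add: G_def)
      then have "(\<Prod>c\<in>Basis - {b}. \<integral>\<^sup>+ x. G c x \<partial>lborel) = (\<Prod>c\<in>Basis - {b}. emeasure lborel S)"
        by (intro prod.cong) simp_all
      then show ?thesis unfolding split mult_1 by (rule arg_cong)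
    qed
    also have "\<dots> = (\<integral>\<^sup>+ x. G b x \<partial>lborel) * emeasure lborel S ^ (n - 1)"
      using b by (simp add: n_def)
    also have "\<dots> \<le> 1 * emeasure lborel S ^ (n - 1)"
      using Gb by (rule mult_right_mono) simp
    finally show ?thesis by (simp add: n_def)
  qed
  \<comment> \<open>The additional power n allows the n Hoelder bounds to be multiplied. Both sides
    then carry the exponent n (n - 1), which is positive and can be cancelled.\<close>
  have "emeasure lborel A ^ ((n - 1) * n) \<le> (\<Prod>b\<in>(Basis::'a set). \<integral>\<^sup>+ x. g b x \<partial>lborel) ^ n"
    unfolding power_mult using LW by (rule power_mono) simp
  also have "\<dots> = (\<Prod>b\<in>(Basis::'a set). (\<integral>\<^sup>+ x. g b x \<partial>lborel) ^ n)" by (rule prod_power_distrib)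
  also have "\<dots> \<le> (\<Prod>b\<in>(Basis::'a set). emeasure lborel S ^ (n - 1))"
    using Ho by (intro prod_mono_ennreal) auto
  also have "\<dots> = emeasure lborel S ^ ((n - 1) * n)" by (simp add: n_def power_mult)
  finally have "emeasure lborel A \<le> emeasure lborel S"
    by (rule power_le_imp_le_ennreal) (use n in simp)
  then show ?thesis unfolding A_def S_def .
qed

text \<open>Cut the range of \<open>\<bar>\<psi>\<bar>\<close> into \<open>2 M\<close> slabs of height \<open>h\<close> with \<open>h ^ n = K / M\<close>.  At most \<open>M\<close> of them carry
  more energy than \<open>h ^ n\<close>, and crossing any other one halves the measure of the superlevel set.\<close>

lemma emeasure_superlevel_decay:
  fixes \<psi> :: "'a::euclidean_space \<Rightarrow> real" and D :: "'a \<Rightarrow> 'a \<Rightarrow> real" and G :: "'a \<Rightarrow> real"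
  assumes dim: "DIM('a) \<ge> 2"
    and der: "\<And>b x s. b \<in> Basis \<Longrightarrow> ((\<lambda>s. \<psi> (x + s *\<^sub>R b)) has_real_derivative D b (x + s *\<^sub>R b)) (at s)"
    and contD: "\<And>b. b \<in> Basis \<Longrightarrow> continuous_on UNIV (D b)"
    and cont: "continuous_on UNIV \<psi>"
    and \<Omega> [measurable]: "\<Omega> \<in> sets borel" "bounded \<Omega>" and supp: "{x. \<psi> x \<noteq> 0} \<subseteq> \<Omega>"
    and G [measurable]: "G \<in> borel_measurable borel"
    and DG: "\<And>b x. b \<in> Basis \<Longrightarrow> \<bar>D b x\<bar> \<le> G x"
    and E: "(\<integral>\<^sup>+ x. ennreal (G x ^ DIM('a)) \<partial>lborel) \<le> ennreal K" and K: "K > 0"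
    and M: "M > 0"
  shows "2 ^ M * emeasure lborel {x\<in>\<Omega>. 2 * M * root DIM('a) (K / M) \<le> \<bar>\<psi> x\<bar>} \<le> emeasure lborel \<Omega>"
proof -
  define n where "n = DIM('a)"
  have n: "n \<ge> 2" using dim unfolding n_def .
  define h where "h = root n (K / M)"
  have h: "h > 0" using K M n unfolding h_def by simp
  have hn: "h ^ n = K / M" using K M n unfolding h_def by simp
  have [measurable]: "\<psi> \<in> borel_measurable borel"
    using cont by (rule borel_measurable_continuous_onI)
  \<comment> \<open>Intersecting with \<Omega> makes \<open>A 0\<close> all of \<Omega>, the start
    of the iteration. For the slabs the strict lower bound already forces \<psi> to be nonzero, even
    in slab 0, so they lie in \<Omega> anyway.\<close>
  define A where "A j = {x\<in>\<Omega>. real j * h \<le> \<bar>\<psi> x\<bar>}" for j :: nat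
  define S where "S j = {x. real j * h < \<bar>\<psi> x\<bar> \<and> \<bar>\<psi> x\<bar> < real j * h + h}" for j :: nat
  define e where "e j = (\<integral>\<^sup>+ x. indicator (S j) x * ennreal (G x ^ n) \<partial>lborel)" for j
  have [measurable]: "A j \<in> sets borel" "S j \<in> sets borel" for j unfolding A_def S_def by measurable
  have bs: "bounded {x. \<psi> x \<noteq> 0}" using \<Omega>(2) supp by (rule bounded_subset)
  have Gnn: "G x \<ge> 0" for x using DG[OF SOME_Basis, of x] abs_ge_zero order_trans by blast
  have mono: "emeasure lborel (A (Suc j)) \<le> emeasure lborel (A j)" for j
    using h by (intro emeasure_mono) (auto simp: A_def algebra_simps)
  have half: "2 * emeasure lborel (A (Suc j)) \<le> emeasure lborel (A j)" if good: "e j \<le> ennreal (h ^ n)" for j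
  proof -
    have le: "emeasure lborel {x. real j * h + h \<le> \<bar>\<psi> x\<bar>} \<le> emeasure lborel (S j)"
      unfolding S_def
    proof (rule emeasure_superlevel_le_slab[OF dim der contD cont bs _ h])
      fix b :: 'a assume b: "b \<in> Basis"
      have "(\<integral>\<^sup>+ x. indicator (S j) x * ennreal (\<bar>D b x\<bar> ^ n) \<partial>lborel) \<le> e j"
        unfolding e_def using DG[OF b] 
        by (intro nn_integral_mono mult_left_mono ennreal_leI power_mono) auto
      then show "(\<integral>\<^sup>+ x. indicator {x. real j * h < \<bar>\<psi> x\<bar> \<and> \<bar>\<psi> x\<bar> < real j * h + h} x *
          ennreal (\<bar>D b x\<bar> ^ DIM('a)) \<partial>lborel) \<le> ennreal (h ^ DIM('a))"
        using good unfolding S_def n_def by (rule order_trans)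
    qed (use h in auto)
    have pos: "real j * h + h > 0" "real j * h \<ge> 0" using h by (auto intro: add_nonneg_pos)
    have "{x. real j * h + h \<le> \<bar>\<psi> x\<bar>} = A (Suc j)"
      using supp pos unfolding A_def by (auto simp: algebra_simps)
    \<comment> \<open>\<open>A (Suc j)\<close> and \<open>S j\<close> are disjoint subsets of
      \<open>A j\<close>; if the first is no larger than the second, it takes up at most half of
      \<open>A j\<close>.\<close>
    then have "2 * emeasure lborel (A (Suc j)) \<le> emeasure lborel (A (Suc j)) + emeasure lborel (S j)"
      using le by (simp add: mult_2 add_mono)
    also have "\<dots> = emeasure lborel (A (Suc j) \<union> S j)"
      by (rule plus_emeasure) (auto simp: A_def S_def algebra_simps)
    also have "\<dots> \<le> emeasure lborel (A j)"
    proof (rule emeasure_mono)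
      have "S j \<subseteq> \<Omega>" using supp pos(2) unfolding S_def
        by (smt (verit) mem_Collect_eq subset_iff)
      then show "A (Suc j) \<union> S j \<subseteq> A j" using h by (auto simp: A_def S_def algebra_simps)
    qed simp
    finally show ?thesis .
  qed
  have iter: "2 ^ card {j. j < N \<and> e j \<le> ennreal (h ^ n)} * emeasure lborel (A N) \<le> emeasure lborel \<Omega>" for N
  proof (induction N)
    case 0
    then show ?case by (simp add: emeasure_mono A_def)
  next
    case (Suc N)
    let ?c = "\<lambda>N. card {j. j < N \<and> e j \<le> ennreal (h ^ n)}"
    have "2 ^ ?c (Suc N) * emeasure lborel (A (Suc N)) \<le> 2 ^ ?c N * emeasure lborel (A N)"
    proof (cases "e N \<le> ennreal (h ^ n)")
      case True
      have "{j. j < Suc N \<and> e j \<le> ennreal (h ^ n)} = insert N {j. j < N \<and> e j \<le> ennreal (h ^ n)}"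
        using True by auto
      then have "?c (Suc N) = Suc (?c N)" by simp
      then have "2 ^ ?c (Suc N) * emeasure lborel (A (Suc N)) = 2 ^ ?c N * (2 * emeasure lborel (A (Suc N)))"
        by (simp add: mult_ac)
      then show ?thesis using half[OF True] by (simp add: mult_left_mono)
    next
      case False
      then have "{j. j < Suc N \<and> e j \<le> ennreal (h ^ n)} = {j. j < N \<and> e j \<le> ennreal (h ^ n)}"
        using less_Suc_eq by auto
      then show ?thesis using mono[of N] by (simp add: mult_left_mono)
    qed
    then show ?case using Suc.IH by (rule order_trans)
  qed
  \<comment> \<open>The slabs are pairwise disjoint, so their energies add up to at most K. Each bad
    one exceeds h^n = K / M, which leaves room for at most M of them among 2 M.\<close>
  define bad where "bad = {j. j < 2 * M \<and> \<not> e j \<le> ennreal (h ^ n)}"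
  have finbad: "finite bad" unfolding bad_def by simp
  have "ennreal (real (card bad) * h ^ n) = (\<Sum>j\<in>bad. ennreal (h ^ n))"
    using h by (simp add: ennreal_mult ennreal_of_nat_eq_real_of_nat)
  also have "\<dots> \<le> (\<Sum>j\<in>bad. e j)" by (intro sum_mono) (auto simp: bad_def)
  also have "\<dots> = (\<integral>\<^sup>+ x. (\<Sum>j\<in>bad. indicator (S j) x) * ennreal (G x ^ n) \<partial>lborel)"
    unfolding e_def by (simp add: nn_integral_sum[symmetric] sum_distrib_right)
  also have "\<dots> \<le> (\<integral>\<^sup>+ x. 1 * ennreal (G x ^ n) \<partial>lborel)"
  proof (intro nn_integral_mono mult_right_mono)
    fix x
    have "disjoint_family_on S bad"
    proof (unfold disjoint_family_on_def, intro ballI impI)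
      have "S i \<inter> S j = {}" if "i < j" for i j
      proof -
        have "real i * h + h \<le> real j * h"
          using that h by (metis Suc_leI add.commute distrib_right mult_1 mult_le_cancel_right_pos of_nat_Suc of_nat_le_iff)
        then show ?thesis unfolding S_def by auto
      qed
      then show "S i \<inter> S j = {}" if "i \<noteq> j" for i j
        using that by (metis Int_commute linorder_neqE_nat)
    qed
    then have "(\<Sum>j\<in>bad. indicator (S j) x) = (indicator (\<Union>j\<in>bad. S j) x :: ennreal)"
      using finbad by (simp add: indicator_UN_disjoint)
    then show "(\<Sum>j\<in>bad. indicator (S j) x) \<le> (1 :: ennreal)" by (simp add: indicator_def)
  qed auto
  also have "\<dots> \<le> ennreal K" using E unfolding n_def by simp
  finally have "real (card bad) * h ^ n \<le> K" using K by (simp add: ennreal_le_iff)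
  then have "card bad \<le> M" using K M by (simp add: hn field_simps)
  moreover have "card {j. j < 2 * M \<and> e j \<le> ennreal (h ^ n)} + card bad = card {..<2 * M}"
  proof -
    have "{j. j < 2 * M \<and> e j \<le> ennreal (h ^ n)} \<union> bad = {..<2 * M}" unfolding bad_def by auto
    then show ?thesis by (subst card_Un_disjoint[symmetric]) (auto simp: bad_def)
  qed
  ultimately have "M \<le> card {j. j < 2 * M \<and> e j \<le> ennreal (h ^ n)}" by simp
  then have "(2::ennreal) ^ M \<le> 2 ^ card {j. j < 2 * M \<and> e j \<le> ennreal (h ^ n)}"
    by (intro power_increasing) auto
  then have "2 ^ M * emeasure lborel (A (2 * M)) \<le> emeasure lborel \<Omega>"
    using iter[of "2 * M"] by (meson mult_right_mono order_trans zero_le)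
  then show ?thesis unfolding A_def h_def n_def by simp
qed

section \<open>From geometric decay to the exponential integral\<close>

text \<open>Where w lies between k and k + 1 the integrand is at most exp ((k + 1) / 2), on a set of
  measure at most 2^(-k) times the total. The coefficient 1/2 in the exponent makes the ratio exp
  (1/2) / 2 of the resulting geometric series less than 1; the constant is the sum of that
  series.\<close>

lemma nn_integral_exp_le_superlevel_decay:
  fixes w :: "'a \<Rightarrow> real"
  assumes [measurable]: "w \<in> borel_measurable M" and w0: "\<And>x. w x \<ge> 0"
    and fin: "emeasure M (space M) < \<infinity>"
    and decay: "\<And>k::nat. k > 0 \<Longrightarrow> 2 ^ k * emeasure M {x\<in>space M. real k \<le> w x} \<le> emeasure M (space M)"
  shows "(\<integral>\<^sup>+ x. ennreal (exp (w x / 2)) \<partial>M) \<le> ennreal (exp (1/2) / (1 - exp (1/2) / 2)) * emeasure M (space M)"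
proof -
  define q where "q = exp (1/2::real) / 2"
  \<comment> \<open>exp (1/2) < 2 follows by squaring from exp 1 \<le> 3 < 4.\<close>
  have "exp (1/2::real) ^ 2 = exp 1" using exp_double[of "1/2::real"] by simp
  also have "exp (1::real) < 2 ^ 2" using exp_le by simp
  finally have "exp (1/2::real) < 2" by (rule power_less_imp_less_base) simp
  then have q: "0 < q" "q < 1" unfolding q_def by auto
  define A where "A k = {x\<in>space M. real k \<le> w x}" for k
  have [measurable]: "A k \<in> sets M" for k unfolding A_def by measurable
  obtain m where m: "emeasure M (space M) = ennreal m" "m \<ge> 0"
    using fin by (cases "emeasure M (space M)") auto
  have Am: "ennreal (exp ((real k + 1) / 2)) * emeasure M (A k) \<le> ennreal (exp (1/2) * m * q ^ k)" for k
  proof -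
    have "2 ^ k * emeasure M (A k) \<le> emeasure M (space M)"
    proof (cases k)
      case 0
      then show ?thesis by (simp add: emeasure_mono A_def)
    qed (use decay[of k] in \<open>simp add: A_def\<close>)
    then have "ennreal (exp (1/2) * q ^ k) * (2 ^ k * emeasure M (A k)) \<le> ennreal (exp (1/2) * q ^ k) * ennreal m"
      unfolding m(1) by (rule mult_left_mono) simp
    moreover have "ennreal (exp (1/2) * q ^ k) * 2 ^ k = ennreal (exp ((real k + 1) / 2))"
    proof -
      have "ennreal (exp (1/2) * q ^ k) * 2 ^ k = ennreal (exp (1/2) * q ^ k) * ennreal (2 ^ k)"
        by (metis ennreal_numeral ennreal_power zero_le_numeral)
      also have "\<dots> = ennreal (exp (1/2) * q ^ k * 2 ^ k)" using q by (simp add: ennreal_mult')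
      also have "exp (1/2) * q ^ k * 2 ^ k = exp (1/2) * exp (1/2) ^ k" 
        unfolding q_def by (simp add: power_divide)
      also have "\<dots> = exp (1/2 + real k * (1/2))"
        by (simp only: exp_add exp_of_nat_mult)
      also have "1/2 + real k * (1/2) = (real k + 1) / 2" by simp
      finally show ?thesis .
    qed
    moreover have "ennreal (exp (1/2) * q ^ k) * ennreal m = ennreal (exp (1/2) * m * q ^ k)"
      using m q by (simp add: ennreal_mult'[symmetric] mult_ac)
    ultimately show ?thesis by (metis mult.assoc)
  qed
  have "(\<integral>\<^sup>+ x. ennreal (exp (w x / 2)) \<partial>M) \<le> (\<integral>\<^sup>+ x. (\<Sum>k. ennreal (exp ((real k + 1) / 2)) * indicator (A k) x) \<partial>M)"
  proof (rule nn_integral_mono)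
    fix x assume x: "x \<in> space M"
    define k where "k = nat \<lfloor>w x\<rfloor>"
    have k: "real k \<le> w x" "w x \<le> real k + 1" using w0[of x] unfolding k_def by linarith+
    have "ennreal (exp (w x / 2)) \<le> ennreal (exp ((real k + 1) / 2)) * indicator (A k) x"
      using k x by (auto simp: A_def intro!: ennreal_leI)
    also have "\<dots> \<le> (\<Sum>k. ennreal (exp ((real k + 1) / 2)) * indicator (A k) x)"
    proof -
      have "sum f {k} \<le> suminf f" for f :: "nat \<Rightarrow> ennreal"
        by (rule sum_le_suminf) auto
      then show ?thesis by fastforce
    qed
    finally show "ennreal (exp (w x / 2)) \<le> \<dots>" .
  qed
  also have "\<dots> = (\<Sum>k. ennreal (exp ((real k + 1) / 2)) * emeasure M (A k))"
    by (subst nn_integral_suminf) (auto simp: nn_integral_cmult_indicator)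
  also have "\<dots> \<le> (\<Sum>k. ennreal (exp (1/2) * m * q ^ k))"
    by (intro suminf_le Am) auto
  also have "\<dots> = ennreal (exp (1/2) * m * (1 / (1 - q)))"
    using q m by (intro suminf_ennreal_eq sums_mult geometric_sums) auto
  also have "\<dots> = ennreal (exp (1/2) / (1 - q)) * ennreal m"
    using q m by (simp add: ennreal_mult'[symmetric])
  finally show ?thesis unfolding m(1) q_def .
qed

text \<open>The decay estimate lives at the levels 2 k (K / k)^(1/n) = 2 K^(1/n) k^((n-1)/n) of
  \<bar>\<psi>\<bar>. Dividing by 2 K^(1/n) and raising to the power n / (n - 1) turns them into the
  integers k, so the rescaled function \<open>w\<close> meets the hypothesis of the preceding
  lemma.\<close>

theorem Trudinger_C1:
  fixes \<psi> :: "'a::euclidean_space \<Rightarrow> real" and D :: "'a \<Rightarrow> 'a \<Rightarrow> real" and G :: "'a \<Rightarrow> real"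
  assumes dim: "DIM('a) \<ge> 2"
    and der: "\<And>b x s. b \<in> Basis \<Longrightarrow> ((\<lambda>s. \<psi> (x + s *\<^sub>R b)) has_real_derivative D b (x + s *\<^sub>R b)) (at s)"
    and contD: "\<And>b. b \<in> Basis \<Longrightarrow> continuous_on UNIV (D b)"
    and cont: "continuous_on UNIV \<psi>"
    and \<Omega> [measurable]: "\<Omega> \<in> sets borel" "bounded \<Omega>" and supp: "{x. \<psi> x \<noteq> 0} \<subseteq> \<Omega>"
    and G [measurable]: "G \<in> borel_measurable borel"
    and DG: "\<And>b x. b \<in> Basis \<Longrightarrow> \<bar>D b x\<bar> \<le> G x"
    and E: "(\<integral>\<^sup>+ x. ennreal (G x ^ DIM('a)) \<partial>lborel) \<le> ennreal K" and K: "K > 0"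
  shows "(\<integral>\<^sup>+ x\<in>\<Omega>. ennreal (exp ((\<bar>\<psi> x\<bar> / (2 * root DIM('a) K)) powr (DIM('a) / (DIM('a) - 1)) / 2)) \<partial>lborel)
    \<le> ennreal (exp (1/2) / (1 - exp (1/2) / 2)) * emeasure lborel \<Omega>"
proof -
  define n where "n = DIM('a)"
  have n: "n \<ge> 2" using dim unfolding n_def .
  define r where "r = root n K"
  have r: "r > 0" using K n unfolding r_def by simp
  define w where "w x = (\<bar>\<psi> x\<bar> / (2 * r)) powr (n / (n - 1))" for x
  have \<psi> [measurable]: "\<psi> \<in> borel_measurable borel"
    using cont by (rule borel_measurable_continuous_onI)
  have wm [measurable]: "w \<in> borel_measurable borel" unfolding w_def by measurable
  let ?M = "restrict_space lborel \<Omega>"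
  have sp: "space ?M = \<Omega>" by (simp add: space_restrict_space)
  have em: "emeasure ?M B = emeasure lborel B" if "B \<subseteq> \<Omega>" for B
    using that by (simp add: emeasure_restrict_space)
  have "(\<integral>\<^sup>+ x. ennreal (exp (w x / 2)) \<partial>?M) \<le> ennreal (exp (1/2) / (1 - exp (1/2) / 2)) * emeasure ?M (space ?M)"
  proof (rule nn_integral_exp_le_superlevel_decay)
    show "w \<in> borel_measurable ?M" using wm by (simp add: measurable_restrict_space1)
    show "w x \<ge> 0" for x by (simp add: w_def)
    show "emeasure ?M (space ?M) < \<infinity>"
      using emeasure_bounded_finite[OF \<Omega>(2)] by (simp add: sp em)
    fix k :: nat assume k: "k > 0"
    have "{x\<in>\<Omega>. real k \<le> w x} = {x\<in>\<Omega>. 2 * k * root n (K / k) \<le> \<bar>\<psi> x\<bar>}"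
    proof (intro Collect_cong conj_cong refl)
      fix x
      have "real k \<le> w x \<longleftrightarrow> real k powr ((n - 1) / n) \<le> w x powr ((n - 1) / n)"
      proof
        assume "real k \<le> w x"
        then show "real k powr ((n - 1) / n) \<le> w x powr ((n - 1) / n)"
          by (intro powr_mono2) auto
      next
        assume *: "real k powr ((n - 1) / n) \<le> w x powr ((n - 1) / n)"
        have "w x powr ((n - 1) / n) < real k powr ((n - 1) / n)" if "w x < real k"
          using that n by (intro powr_less_mono2) (auto simp: w_def)
        then show "real k \<le> w x" using * by force
      qed
      also have "w x powr ((n - 1) / n) = \<bar>\<psi> x\<bar> / (2 * r)"
        using n r by (simp add: w_def powr_powr)
      also have "real k powr ((n - 1) / n) \<le> \<bar>\<psi> x\<bar> / (2 * r) \<longleftrightarrow> 2 * (r * real k powr ((n - 1) / n)) \<le> \<bar>\<psi> x\<bar>"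
        using r by (simp add: field_simps)
      also have "r * real k powr ((n - 1) / n) = real k * root n (K / k)"
      proof -
        have "real k powr ((n - 1) / n) = real k powr (1 - 1 / n)"
          using n by (simp add: of_nat_diff diff_divide_distrib)
        also have "\<dots> = real k / root n k"
          using n k by (simp add: powr_diff root_powr_inverse)
        finally show ?thesis using n k unfolding r_def by (simp add: real_root_divide)
      qed
      finally show "real k \<le> w x \<longleftrightarrow> 2 * k * root n (K / k) \<le> \<bar>\<psi> x\<bar>" by (simp add: mult.assoc)
    qed
    then show "2 ^ k * emeasure ?M {x\<in>space ?M. real k \<le> w x} \<le> emeasure ?M (space ?M)"
      using emeasure_superlevel_decay[OF assms k] by (simp add: sp em n_def)
  qed
  then show ?thesis
    by (simp add: sp em nn_integral_restrict_space w_def n_def r_def)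
qed

section \<open>Test functions and weak gradients\<close>

lemma has_derivative_imp_partial:
  assumes "(f has_derivative f') (at x)"
  shows "partial i f x = f' (axis i 1)"
  using frechet_derivative_at[OF assms] by (simp add: partial_def)

lemma differentiable_imp_has_derivative_frechet:
  "f differentiable at x \<Longrightarrow> (f has_derivative frechet_derivative f (at x)) (at x)"
  by (simp add: frechet_derivative_works)

lemma partial_add:
  assumes "f differentiable at x" "g differentiable at x"
  shows "partial i (\<lambda>x. f x + g x) x = partial i f x + partial i g x"
  by (subst has_derivative_imp_partial[OF has_derivative_add[OF
        differentiable_imp_has_derivative_frechet[OF assms(1)] differentiable_imp_has_derivative_frechet[OF assms(2)]]])
     (simp add: partial_def)

lemma partial_mult:
  assumes "f differentiable at x" "g differentiable at x"
  shows "partial i (\<lambda>x. f x * g x) x = f x * partial i g x + partial i f x * g x"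
  by (subst has_derivative_imp_partial[OF has_derivative_mult[OF
        differentiable_imp_has_derivative_frechet[OF assms(1)] differentiable_imp_has_derivative_frechet[OF assms(2)]]])
     (simp add: partial_def)

lemma partial_const [simp]: "partial i (\<lambda>x. c) x = 0"
  by (subst has_derivative_imp_partial[OF has_derivative_const]) simp

lemma differentiable_imp_DERIV_partial:
  fixes f :: "real^'n::finite \<Rightarrow> real"
  assumes "f differentiable at (x + s *\<^sub>R axis i 1)"
  shows "((\<lambda>s. f (x + s *\<^sub>R axis i 1)) has_real_derivative partial i f (x + s *\<^sub>R axis i 1)) (at s)"
proof -
  let ?D = "frechet_derivative f (at (x + s *\<^sub>R axis i 1))"
  have "((\<lambda>s. x + s *\<^sub>R (axis i 1 :: real^'n)) has_derivative (\<lambda>t. t *\<^sub>R axis i 1)) (at s)"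
    by (auto intro!: derivative_eq_intros)
  from has_derivative_compose[OF this differentiable_imp_has_derivative_frechet[OF assms]]
  have "((\<lambda>s. f (x + s *\<^sub>R axis i 1)) has_derivative (\<lambda>t. ?D (t *\<^sub>R axis i 1))) (at s)" .
  moreover have "(\<lambda>t. ?D (t *\<^sub>R axis i 1)) = (*) (partial i f (x + s *\<^sub>R axis i 1))"
    using linear_frechet_derivative[OF assms]
    by (auto simp: partial_def linear_scale mult.commute fun_eq_iff)
  ultimately show ?thesis by (simp add: has_field_derivative_def)
qed

lemma Ck_on_UNIV_imp_continuous: "Ck_on k UNIV f \<Longrightarrow> continuous_on UNIV f"
  by (cases k) (auto intro!: continuous_at_imp_continuous_on differentiable_imp_continuous_within)

lemma Ck_on_UNIV_Suc_imp: "Ck_on (Suc k) UNIV f \<Longrightarrow> Ck_on k UNIV f"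
proof (induction k arbitrary: f)
  case 0
  then show ?case by (metis Ck_on.simps(1) Ck_on_UNIV_imp_continuous)
next
  case (Suc k)
  then show ?case using Ck_on.simps(2) by blast
qed

lemma Ck_on_UNIV_const [simp]: "Ck_on k UNIV (\<lambda>x::real^'n::finite. c)"
proof (induction k arbitrary: c)
  case (Suc k)
  have "partial i (\<lambda>x::real^'n. c) = (\<lambda>x. 0)" for i by (rule ext) simp
  then show ?case using Suc by simp
qed simp

lemma Ck_on_UNIV_add:
  "Ck_on k UNIV f \<Longrightarrow> Ck_on k UNIV g \<Longrightarrow> Ck_on k UNIV (\<lambda>x. f x + g x)"
proof (induction k arbitrary: f g)
  case (Suc k)
  then have "partial i (\<lambda>x. f x + g x) = (\<lambda>x. partial i f x + partial i g x)" for i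
    by (intro ext partial_add) auto
  then show ?case using Suc by auto
qed (auto intro: continuous_on_add)

lemma Ck_on_UNIV_mult:
  "Ck_on k UNIV f \<Longrightarrow> Ck_on k UNIV g \<Longrightarrow> Ck_on k UNIV (\<lambda>x. f x * g x)"
proof (induction k arbitrary: f g)
  case (Suc k)
  have "partial i (\<lambda>x. f x * g x) = (\<lambda>x. f x * partial i g x + partial i f x * g x)" for i
    using Suc.prems by (intro ext partial_mult) auto
  moreover have "Ck_on k UNIV (\<lambda>x. f x * partial i g x + partial i f x * g x)" for i
    using Suc.prems Ck_on_UNIV_Suc_imp by (intro Ck_on_UNIV_add Suc.IH) auto
  ultimately show ?case using Suc.prems by (auto intro: differentiable_mult)
qed (auto intro: continuous_on_mult)

lemma Ck_on_UNIV_prod: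
  "finite I \<Longrightarrow> (\<And>i. i \<in> I \<Longrightarrow> Ck_on k UNIV (f i)) \<Longrightarrow> Ck_on k UNIV (\<lambda>x. \<Prod>i\<in>I. f i x)"
  by (induction I rule: finite_induct) (auto intro: Ck_on_UNIV_mult)

text \<open>The family \<open>p (1/x) exp (-1/x)\<close> is closed under differentiation, which gives smoothness at once;
  the bumps built from it converge to the indicator of a box.\<close>

definition flat :: "real poly \<Rightarrow> real \<Rightarrow> real" where
  "flat p x = (if x > 0 then poly p (1 / x) * exp (- (1 / x)) else 0)"

lemma poly_mult_exp_minus_tendsto_0: "((\<lambda>y. poly p y * exp (- y)) \<longlongrightarrow> (0::real)) at_top"
proof -
  have "((\<lambda>y. \<Sum>i\<le>degree p. coeff p i * (y ^ i / exp y)) \<longlongrightarrow> (\<Sum>i\<le>degree p. coeff p i * 0)) at_top"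
    by (intro tendsto_sum tendsto_mult tendsto_const tendsto_power_div_exp_0)
  then show ?thesis by (simp add: poly_altdef sum_distrib_right exp_minus divide_inverse mult.assoc)
qed

text \<open>For x > 0 the derivative of p(1/x) exp(-1/x) is (p(1/x) - p'(1/x)) / x^2 times the
  exponential, and 1/x^2 is the polynomial \<open>[:0, 0, 1:]\<close> in the variable 1/x.\<close>

lemma DERIV_flat: "(flat p has_real_derivative flat ([:0, 0, 1:] * (p - pderiv p)) x) (at x)"
proof -
  let ?q = "[:0, 0, 1:] * (p - pderiv p)"
  consider "x < 0" | "x > 0" | "x = 0" by linarith
  then show ?thesis
  proof cases
    case 1
    have "((\<lambda>x. 0) has_real_derivative 0) (at x)" by simp
    then have "(flat p has_real_derivative 0) (at x)"
      by (rule DERIV_cong_ev[OF refl _ refl, THEN iffD1, rotated])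
         (use 1 eventually_nhds_in_open[of "{..<0}" x] in \<open>auto simp: flat_def elim!: eventually_mono\<close>)
    then show ?thesis using 1 by (simp add: flat_def)
  next
    case 2
    have "((\<lambda>x. poly p (1 / x) * exp (- (1 / x))) has_real_derivative poly ?q (1 / x) * exp (- (1 / x))) (at x)"
      using 2 by (auto intro!: derivative_eq_intros DERIV_chain'[of "\<lambda>x. 1 / x", OF _ poly_DERIV] simp: field_simps power2_eq_square)
    then have "(flat p has_real_derivative poly ?q (1 / x) * exp (- (1 / x))) (at x)"
      by (rule DERIV_cong_ev[OF refl _ refl, THEN iffD1, rotated])
         (use 2 eventually_nhds_in_open[of "{0<..}" x] in \<open>auto simp: flat_def elim!: eventually_mono\<close>)
    then show ?thesis using 2 by (simp add: flat_def)
  next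
    case 3
    have "((\<lambda>h. (flat p (0 + h) - flat p 0) / h) \<longlongrightarrow> 0) (at 0)"
    proof (rule filterlim_split_at)
      have "((\<lambda>h. 0) \<longlongrightarrow> (0::real)) (at_left 0)" by simp
      then show "((\<lambda>h. (flat p (0 + h) - flat p 0) / h) \<longlongrightarrow> 0) (at_left 0)"
        by (rule tendsto_cong[THEN iffD1, rotated]) 
           (auto simp: flat_def eventually_at_filter)
      \<comment> \<open>At 0 the difference quotient from the right is y p(y) exp(-y) with y = 1/h;
        dividing by h accounts for the factor \<open>[:0, 1:]\<close>.\<close>
      have "((\<lambda>h. poly ([:0, 1:] * p) (inverse h) * exp (- inverse h)) \<longlongrightarrow> (0::real)) (at_right 0)"
        using poly_mult_exp_minus_tendsto_0 filterlim_inverse_at_top_right by (rule filterlim_compose)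
      then show "((\<lambda>h. (flat p (0 + h) - flat p 0) / h) \<longlongrightarrow> 0) (at_right 0)"
        by (rule tendsto_cong[THEN iffD1, rotated]) 
           (auto simp: flat_def eventually_at_filter field_simps)
    qed
    then show ?thesis using 3 by (simp add: DERIV_def flat_def)
  qed
qed

text \<open>The factor r belongs to the statement because each differentiation brings out c and
  changes the polynomial; the induction therefore runs over all r and p at once.\<close>

lemma Ck_on_UNIV_flat:
  fixes i :: "'n::finite"
  shows "Ck_on k UNIV (\<lambda>x. r * flat p (c * x $ i + d))"
proof (induction k arbitrary: r p)
  case 0
  have "continuous_on UNIV (flat p)"
    using DERIV_flat DERIV_isCont continuous_at_imp_continuous_on by blast
  then have "continuous_on UNIV (\<lambda>x::real^'n. flat p (c * x $ i + d))"
    by (rule continuous_on_compose2) (auto intro!: continuous_intros)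
  then show ?case by (auto intro!: continuous_intros)
next
  case (Suc k)
  let ?q = "[:0, 0, 1:] * (p - pderiv p)"
  have der: "((\<lambda>x::real^'n. r * flat p (c * x $ i + d)) has_derivative 
    (\<lambda>v. r * (c * v $ i * flat ?q (c * x $ i + d)))) (at x)" for x
  proof -
    have "((\<lambda>x::real^'n. c * x $ i + d) has_derivative (\<lambda>v. c * v $ i)) (at x)"
      by (auto intro!: derivative_eq_intros bounded_linear_imp_has_derivative bounded_linear_vec_nth)
    from DERIV_compose_FDERIV[OF DERIV_flat this] show ?thesis
      by (rule has_derivative_mult_right)
  qed
  have "partial j (\<lambda>x. r * flat p (c * x $ i + d)) = (\<lambda>x. (if j = i then r * c else 0) * flat ?q (c * x $ i + d))" for j
    by (rule ext) (subst has_derivative_imp_partial[OF der], auto simp: axis_def)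
  moreover have "(\<lambda>x. r * flat p (c * x $ i + d)) differentiable at x" for x
    unfolding differentiable_def using der by blast
  ultimately show ?case using Suc by simp
qed

text \<open>Since \<open>flat 1 (real j * y)\<close> tends to 1 for y > 0 and is 0 otherwise, the
  parameter j sharpens the bump inside a fixed open box while its support never leaves the closed
  box.\<close>

definition box_bump :: "real^'n \<Rightarrow> real^'n \<Rightarrow> nat \<Rightarrow> real^'n::finite \<Rightarrow> real" where
  "box_bump a b j x = (\<Prod>i\<in>UNIV. flat 1 (real j * (x $ i - a $ i)) * flat 1 (real j * (b $ i - x $ i)))"

lemma Ck_on_UNIV_box_bump: "Ck_on k UNIV (box_bump a b j)"
proof -
  have "Ck_on k UNIV (\<lambda>x. (1 * flat 1 (real j * x $ i + - (real j * a $ i))) * (1 * flat 1 (- real j * x $ i + real j * b $ i)))" for i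
    by (intro Ck_on_UNIV_mult Ck_on_UNIV_flat)
  then show ?thesis unfolding box_bump_def
    by (intro Ck_on_UNIV_prod) (simp_all add: algebra_simps)
qed

lemma flat_1_bounds: "0 \<le> flat 1 x" "flat 1 x \<le> 1"
  by (auto simp: flat_def)

lemma box_bump_bounds: "0 \<le> box_bump a b j x" "box_bump a b j x \<le> 1"
  unfolding box_bump_def
  by (auto intro!: prod_nonneg prod_le_1 mult_nonneg_nonneg mult_le_one simp: flat_1_bounds)

lemma box_bump_eq_0: "x \<notin> box a b \<Longrightarrow> box_bump a b j x = 0"
proof -
  assume "x \<notin> box a b"
  then obtain i where "\<not> (a $ i < x $ i \<and> x $ i < b $ i)" by (auto simp: mem_box_cart)
  then have "flat 1 (real j * (x $ i - a $ i)) * flat 1 (real j * (b $ i - x $ i)) = 0"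
    by (auto simp: flat_def zero_less_mult_iff)
  then show ?thesis unfolding box_bump_def by (intro prod_zero) auto
qed

lemma flat_1_tendsto:
  "(\<lambda>j. flat 1 (real j * y)) \<longlonglongrightarrow> (if y > 0 then 1 else 0)"
proof (cases "y > 0")
  case True
  have "(\<lambda>j. exp (- (1 / y) * inverse (real j))) \<longlonglongrightarrow> exp (- (1 / y) * 0)"
    by (intro tendsto_intros lim_inverse_n)
  then have "(\<lambda>j. flat 1 (real j * y)) \<longlonglongrightarrow> exp (- (1 / y) * 0)"
    by (rule Lim_transform_eventually)
       (rule eventually_mono[OF eventually_gt_at_top[of 0]], use True in \<open>simp add: flat_def field_simps\<close>)
  then show ?thesis using True by simp
next
  case False
  then have "flat 1 (real j * y) = 0" for j by (auto simp: flat_def zero_less_mult_iff)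
  then show ?thesis using False by simp
qed

lemma box_bump_tendsto: "(\<lambda>j. box_bump a b j x) \<longlonglongrightarrow> indicator (box a b) x"
proof -
  have "(\<lambda>j. box_bump a b j x) \<longlonglongrightarrow> (\<Prod>i\<in>UNIV. (if x $ i - a $ i > 0 then 1 else 0) * (if b $ i - x $ i > 0 then 1 else 0))"
    unfolding box_bump_def by (intro tendsto_prod tendsto_mult flat_1_tendsto)
  also have "(\<Prod>i\<in>UNIV. (if x $ i - a $ i > 0 then 1 else 0) * (if b $ i - x $ i > 0 then 1 else 0)) = (indicator (box a b) x :: real)"
    by (auto simp: indicator_def mem_box_cart)
  finally show ?thesis .
qed

lemma box_bump_test_function:
  assumes "cbox a b \<subseteq> \<Omega>"
  shows "box_bump a b j \<in> test_functions \<Omega>"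
proof -
  have "closure {x. box_bump a b j x \<noteq> 0} \<subseteq> cbox a b"
    by (rule closure_minimal) (use box_bump_eq_0[of _ a b j] box_subset_cbox[of a b] in \<open>auto simp: closed_cbox\<close>)
  moreover from this have "compact (closure {x. box_bump a b j x \<noteq> 0})"
    by (meson bounded_cbox bounded_subset closed_closure compact_eq_bounded_closed)
  ultimately show ?thesis using assms Ck_on_UNIV_box_bump
    by (auto simp: test_functions_def)
qed

section \<open>Integration by parts for test functions\<close>

lemma integral_lebesgue_on_eq_lborel:
  fixes f :: "'a::euclidean_space \<Rightarrow> real"
  assumes [measurable]: "f \<in> borel_measurable borel" and \<Omega>: "\<Omega> \<in> sets lebesgue"
    and "\<And>x. x \<notin> \<Omega> \<Longrightarrow> f x = 0"
  shows "(\<integral>x. f x \<partial>lebesgue_on \<Omega>) = (\<integral>x. f x \<partial>lborel)"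
proof -
  have "(\<integral>x. f x \<partial>lebesgue_on \<Omega>) = (\<integral>x. indicator \<Omega> x *\<^sub>R f x \<partial>lebesgue)"
    using \<Omega> by (subst integral_restrict_space) (auto simp: )
  also have "\<dots> = (\<integral>x. f x \<partial>lebesgue)"
    using assms(3) by (intro Bochner_Integration.integral_cong) (auto simp: indicator_def)
  also have "\<dots> = (\<integral>x. f x \<partial>lborel)" by (rule integral_completion) simp
  finally show ?thesis .
qed

lemma continuous_bounded_support_bounded:
  fixes f :: "'a::euclidean_space \<Rightarrow> real"
  assumes "continuous_on UNIV f" "bounded {x. f x \<noteq> 0}"
  obtains B where "\<And>x. \<bar>f x\<bar> \<le> B" "B > 0"
proof -
  have "compact (closure {x. f x \<noteq> 0})" using assms(2) by simp
  then have "bounded (f ` closure {x. f x \<noteq> 0})"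
    by (intro compact_imp_bounded compact_continuous_image continuous_on_subset[OF assms(1)]) simp_all
  then obtain B where B: "B > 0" "\<And>x. x \<in> closure {x. f x \<noteq> 0} \<Longrightarrow> \<bar>f x\<bar> \<le> B"
    by (auto simp: bounded_pos)
  have "\<bar>f x\<bar> \<le> B" for x
    using B closure_subset[of "{x. f x \<noteq> 0}"] by (cases "f x = 0") auto
  then show ?thesis using that B by blast
qed

lemma integrable_continuous_bounded_support:
  fixes f :: "'a::euclidean_space \<Rightarrow> real"
  assumes "continuous_on UNIV f" "bounded {x. f x \<noteq> 0}"
  shows "integrable lborel f"
proof -
  have "integrable lborel (\<lambda>x. indicator (closure {x. f x \<noteq> 0}) x *\<^sub>R f x)"
    using assms by (intro borel_integrable_compact) (auto intro: continuous_on_subset)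
  moreover have "(\<lambda>x. indicator (closure {x. f x \<noteq> 0}) x *\<^sub>R f x) = f"
    using closure_subset[of "{x. f x \<noteq> 0}"] by (auto simp: indicator_def fun_eq_iff)
  ultimately show ?thesis by simp
qed

lemma partial_eq_0_outside:
  assumes "x \<notin> closure {x. f x \<noteq> 0}"
  shows "partial i f x = 0"
proof -
  have "((\<lambda>x. 0) has_derivative (\<lambda>x. 0)) (at x)" by simp
  then have "(f has_derivative (\<lambda>x. 0)) (at x)"
    by (rule has_derivative_transform_within_open[where s="- closure {x. f x \<noteq> 0}"])
       (use assms closure_subset[of "{x. f x \<noteq> 0}"] in auto)
  then show ?thesis by (simp add: has_derivative_imp_partial)
qed

lemma bounded_support_partial:
  assumes "bounded {x. f x \<noteq> 0}"
  shows "bounded {x. partial i f x \<noteq> 0}"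
  by (rule bounded_subset[OF bounded_closure[OF assms]]) (use partial_eq_0_outside in auto)

text \<open>Difference quotients have integral 0 by translation invariance and converge to the
  partial derivative. Domination comes from the mean value theorem, which bounds them by B, and from
  step lengths at most 1, which keep them supported in the ball of radius \<bar>r\<bar> + 1.\<close>

lemma integral_partial_eq_0:
  fixes f :: "real^'n::finite \<Rightarrow> real"
  assumes diff: "\<And>x. f differentiable at x" and cont: "continuous_on UNIV (partial i f)"
    and supp: "bounded {x. f x \<noteq> 0}"
  shows "(\<integral>x. partial i f x \<partial>lborel) = 0"
proof -
  have cf: "continuous_on UNIV f"
    using diff by (auto intro!: continuous_at_imp_continuous_on differentiable_imp_continuous_within)
  have [measurable]: "f \<in> borel_measurable borel" "partial i f \<in> borel_measurable borel"
    using cf cont by (auto intro: borel_measurable_continuous_onI)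
  obtain B where B: "\<And>x. \<bar>partial i f x\<bar> \<le> B" "B > 0"
    using continuous_bounded_support_bounded[OF cont bounded_support_partial[OF supp]] by blast
  obtain r where r: "\<And>x. f x \<noteq> 0 \<Longrightarrow> norm x \<le> r" using supp by (auto simp: bounded_iff)
  define h where "h m = inverse (real (Suc m))" for m
  have h: "0 < h m" "h m \<le> 1" for m unfolding h_def by (auto simp: inverse_le_1_iff)
  define e where "e = (axis i 1 :: real^'n)"
  define T where "T m x = (f (x + h m *\<^sub>R e) - f x) / h m" for m x
  have T0: "(\<integral>x. T m x \<partial>lborel) = 0" for m
  proof -
    have int: "integrable lborel f" using cf supp by (rule integrable_continuous_bounded_support)
    have sh: "(\<integral>x. f (x + h m *\<^sub>R e) \<partial>lborel) = (\<integral>x. f x \<partial>lborel)"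
      by (subst (2) lborel_distr_plus[of "h m *\<^sub>R e", symmetric], subst integral_distr) (auto simp: add.commute)
    have "integrable (distr lborel borel ((+) (h m *\<^sub>R e))) f"
      using int by (simp add: lborel_distr_plus)
    then have "integrable lborel (\<lambda>x. f (x + h m *\<^sub>R e))"
      by (subst (asm) integrable_distr_eq) (auto simp: add.commute)
    then show ?thesis using int sh unfolding T_def by simp
  qed
  have "(\<lambda>m. \<integral>x. T m x \<partial>lborel) \<longlonglongrightarrow> (\<integral>x. partial i f x \<partial>lborel)"
  proof (rule integral_dominated_convergence[where w="\<lambda>x. indicator (cball 0 (\<bar>r\<bar> + 1)) x * B"])
    show "integrable lborel (\<lambda>x::real^'n. indicator (cball 0 (\<bar>r\<bar> + 1)) x * B)"
      using emeasure_lborel_cball_finite[of "0::real^'n" "\<bar>r\<bar> + 1"]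
      by (intro integrable_mult_left) (simp add: integrable_indicator_iff)
    show "AE x in lborel. (\<lambda>m. T m x) \<longlonglongrightarrow> partial i f x"
    proof (rule AE_I2)
      fix x
      have "((\<lambda>s. f (x + s *\<^sub>R e)) has_real_derivative partial i f x) (at 0)"
        using differentiable_imp_DERIV_partial[of f x 0 i] diff by (simp add: e_def)
      then have "((\<lambda>s. (f (x + s *\<^sub>R e) - f x) / s) \<longlongrightarrow> partial i f x) (at 0)"
        by (simp add: DERIV_def)
      moreover have "filterlim h (at 0) sequentially"
        unfolding h_def filterlim_at using LIMSEQ_inverse_real_of_nat by (auto intro: always_eventually)
      ultimately show "(\<lambda>m. T m x) \<longlonglongrightarrow> partial i f x"
        unfolding T_def by (rule filterlim_compose)
    qed
    show "AE x in lborel. norm (T m x) \<le> indicator (cball 0 (\<bar>r\<bar> + 1)) x * B" for m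
    proof (rule AE_I2)
      fix x
      obtain z where z: "f (x + h m *\<^sub>R e) - f (x + 0 *\<^sub>R e) = (h m - 0) * partial i f (x + z *\<^sub>R e)"
        using MVT2[OF h(1)[of m], of "\<lambda>s. f (x + s *\<^sub>R e)" "\<lambda>s. partial i f (x + s *\<^sub>R e)"]
          differentiable_imp_DERIV_partial[OF diff] unfolding e_def by auto
      then have "T m x = partial i f (x + z *\<^sub>R e)" using h(1)[of m] by (simp add: T_def)
      then have TB: "norm (T m x) \<le> B" using B by simp
      show "norm (T m x) \<le> indicator (cball 0 (\<bar>r\<bar> + 1)) x * B"
      proof (cases "norm x \<le> \<bar>r\<bar> + 1")
        case False
        have "norm x \<le> norm (x + h m *\<^sub>R e) + norm (h m *\<^sub>R e)"
          using norm_triangle_ineq4[of "x + h m *\<^sub>R e" "h m *\<^sub>R e"] by simp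
        also have "norm (h m *\<^sub>R e) \<le> 1" using h[of m] by (simp add: e_def)
        finally have "f (x + h m *\<^sub>R e) = 0" "f x = 0"
          using False r[of x] r[of "x + h m *\<^sub>R e"] by (cases "f (x + h m *\<^sub>R e) = 0", simp, linarith) (cases "f x = 0", simp, use False r[of x] in linarith)
        then show ?thesis using B by (simp add: T_def)
      qed (use TB in simp)
    qed
  qed (auto simp: T_def)
  then show ?thesis using T0 LIMSEQ_unique[OF tendsto_const] by force
qed

lemma test_functionD:
  assumes "\<phi> \<in> test_functions \<Omega>"
  shows "\<phi> differentiable at x" "continuous_on UNIV \<phi>" "continuous_on UNIV (partial i \<phi>)"
    "bounded {x. \<phi> x \<noteq> 0}" "{x. \<phi> x \<noteq> 0} \<subseteq> \<Omega>" "x \<notin> \<Omega> \<Longrightarrow> \<phi> x = 0" "x \<notin> \<Omega> \<Longrightarrow> partial i \<phi> x = 0"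
proof -
  have C: "Ck_on 0 UNIV \<phi>" "Ck_on (Suc 0) UNIV \<phi>"
    using assms unfolding test_functions_def by blast+
  then show "\<phi> differentiable at x" "continuous_on UNIV \<phi>" "continuous_on UNIV (partial i \<phi>)" by auto
  have K: "compact (closure {x. \<phi> x \<noteq> 0})" "closure {x. \<phi> x \<noteq> 0} \<subseteq> \<Omega>"
    using assms unfolding test_functions_def by blast+
  then show "bounded {x. \<phi> x \<noteq> 0}" by simp
  show sub: "{x. \<phi> x \<noteq> 0} \<subseteq> \<Omega>" using closure_subset K(2) by (rule order_trans)
  then show "x \<notin> \<Omega> \<Longrightarrow> \<phi> x = 0" by blast
  show "x \<notin> \<Omega> \<Longrightarrow> partial i \<phi> x = 0" using K(2) by (intro partial_eq_0_outside) auto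
qed

lemma continuous_on_grad: "(\<And>i. continuous_on UNIV (partial i \<phi>)) \<Longrightarrow> continuous_on UNIV (grad \<phi>)"
  unfolding grad_def by (intro continuous_on_vec_lambda)

lemma continuous_imp_locally_integrable_on:
  fixes f :: "real^'n::finite \<Rightarrow> 'b::euclidean_space"
  assumes "continuous_on UNIV f"
  shows "locally_integrable_on f \<Omega>"
  unfolding locally_integrable_on_def
proof (intro allI impI)
  fix K :: "(real^'n) set" assume K: "compact K \<and> K \<subseteq> \<Omega>"
  have "integrable lborel (\<lambda>x. indicator K x *\<^sub>R f x)"
    using K assms by (intro borel_integrable_compact) (auto intro: continuous_on_subset)
  then show "f absolutely_integrable_on K"
    unfolding set_integrable_def
    by (subst integrable_completion) (auto dest: borel_measurable_integrable)
qed

text \<open>The product rule for \<phi> \<psi>, whose support is bounded, together with the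
  vanishing integral of its partial derivative.\<close>

lemma is_weak_grad_test_function:
  fixes \<phi> :: "real^'n::finite \<Rightarrow> real"
  assumes \<Omega>: "open \<Omega>" and \<phi>: "\<phi> \<in> test_functions \<Omega>"
  shows "is_weak_grad \<Omega> \<phi> (grad \<phi>)"
  unfolding is_weak_grad_def
proof (intro conjI ballI allI)
  note t\<phi> = test_functionD[OF \<phi>]
  show "locally_integrable_on \<phi> \<Omega>" "locally_integrable_on (grad \<phi>) \<Omega>"
    by (intro continuous_imp_locally_integrable_on continuous_on_grad t\<phi>)+
  fix \<psi> :: "real^'n \<Rightarrow> real" and i assume \<psi>: "\<psi> \<in> test_functions \<Omega>"
  note t\<psi> = test_functionD[OF \<psi>]
  have pm: "partial i (\<lambda>x. \<phi> x * \<psi> x) = (\<lambda>x. \<phi> x * partial i \<psi> x + partial i \<phi> x * \<psi> x)"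
    by (intro ext partial_mult t\<phi> t\<psi>)
  have c: "continuous_on UNIV (\<lambda>x. \<phi> x * partial i \<psi> x)" "continuous_on UNIV (\<lambda>x. partial i \<phi> x * \<psi> x)"
    by (intro continuous_on_mult t\<phi> t\<psi>)+
  have b1: "bounded {x. \<phi> x * F x \<noteq> 0}" for F
    by (rule bounded_subset[OF t\<phi>(4)]) auto
  have b2: "bounded {x. F x * \<psi> x \<noteq> 0}" for F
    by (rule bounded_subset[OF t\<psi>(4)]) auto
  have b3: "bounded {x. \<phi> x * \<psi> x \<noteq> 0}" by (rule b1)
  have int: "integrable lborel (\<lambda>x. \<phi> x * partial i \<psi> x)" "integrable lborel (\<lambda>x. partial i \<phi> x * \<psi> x)"
    by (rule integrable_continuous_bounded_support, rule c, rule b1 b2)+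
  have "(\<integral>x. partial i (\<lambda>x. \<phi> x * \<psi> x) x \<partial>lborel) = 0"
    by (rule integral_partial_eq_0[OF _ _ b3])
       (auto simp: pm intro: continuous_on_add c differentiable_mult t\<phi>(1) t\<psi>(1))
  then have "(\<integral>x. \<phi> x * partial i \<psi> x \<partial>lborel) = - (\<integral>x. partial i \<phi> x * \<psi> x \<partial>lborel)"
    unfolding pm using int by simp
  moreover have "(\<integral>x. F x \<partial>lebesgue_on \<Omega>) = (\<integral>x. F x \<partial>lborel)"
    if "continuous_on UNIV F" "\<And>x. x \<notin> \<Omega> \<Longrightarrow> F x = 0" for F :: "real^'n \<Rightarrow> real"
    using that \<Omega> by (intro integral_lebesgue_on_eq_lborel borel_measurable_continuous_onI) auto
  ultimately show "(\<integral>x. \<phi> x * partial i \<psi> x \<partial>lebesgue_on \<Omega>) = - (\<integral>x. grad \<phi> x $ i * \<psi> x \<partial>lebesgue_on \<Omega>)"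
    using c t\<phi>(6) t\<psi>(6) by (simp add: grad_def)
qed

section \<open>Uniqueness of weak gradients\<close>

text \<open>Extended by 0, f has integral 0 over every box, because boxes intersect in boxes. By
  Lebesgue differentiation the averages over shrinking cubes, all of them 0, converge to the
  extended function off a negligible set.\<close>

lemma negligible_nonzero_of_zero_box_integrals:
  fixes f :: "'a::euclidean_space \<Rightarrow> real"
  assumes f: "f absolutely_integrable_on cbox a b"
    and 0: "\<And>c d. cbox c d \<subseteq> cbox a b \<Longrightarrow> integral (cbox c d) f = 0"
  shows "negligible {x\<in>cbox a b. f x \<noteq> 0}"
proof -
  define F where "F x = (if x \<in> cbox a b then f x else 0)" for x
  have I: "(F has_integral 0) (cbox c d)" for c d
  proof -
    obtain c' d' where cd: "cbox a b \<inter> cbox c d = cbox c' d'" using Int_interval[of a b c d] by blast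
    then have sub: "cbox c' d' \<subseteq> cbox a b" by blast
    have "f integrable_on cbox c' d'"
      by (rule integrable_on_subcbox[OF set_lebesgue_integral_eq_integral(1)[OF f] sub])
    then have "(f has_integral 0) (cbox a b \<inter> cbox c d)"
      unfolding cd using 0[OF sub] by (simp add: has_integral_iff)
    then show ?thesis
      unfolding F_def by (subst (asm) has_integral_restrict_Int[symmetric]) simp
  qed
  obtain N where N: "negligible N" and lim:
    "\<And>x e. \<lbrakk>x \<notin> N; 0 < e\<rbrakk> \<Longrightarrow> \<exists>d>0. \<forall>h. 0 < h \<and> h < d \<longrightarrow>
          norm(integral (cbox x (x + h *\<^sub>R One)) F /\<^sub>R h ^ DIM('a) - F x) < e"
    by (rule integrable_ccontinuous_explicit[of F]) (use I has_integral_integrable in blast)+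
  have "F x = 0" if xN: "x \<notin> N" for x
  proof (rule ccontr)
    assume "F x \<noteq> 0"
    then obtain d where d: "d > 0" "\<And>h. 0 < h \<and> h < d \<Longrightarrow> 
        norm(integral (cbox x (x + h *\<^sub>R One)) F /\<^sub>R h ^ DIM('a) - F x) < norm (F x)"
      using lim[OF xN, of "norm (F x)"] by auto
    have "integral (cbox x (x + (d/2) *\<^sub>R One)) F = 0" using I by (rule integral_unique)
    then show False using d(2)[of "d/2"] d(1) by simp
  qed
  then have "{x\<in>cbox a b. f x \<noteq> 0} \<subseteq> N" by (force simp: F_def)
  then show ?thesis using N by (rule negligible_subset[rotated])
qed

text \<open>Recovers box integrals from pairings with test functions: dominated convergence with
  majorant \<bar>g\<bar> on the closed box, followed by passing from the open to the closed box,
  which differ by a null set.\<close>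

lemma integral_lebesgue_on_box_bump_tendsto:
  fixes g :: "real^'n::finite \<Rightarrow> real"
  assumes g: "locally_integrable_on g \<Omega>" and \<Omega>: "\<Omega> \<in> sets lebesgue" and sub: "cbox a b \<subseteq> \<Omega>"
  shows "(\<lambda>j. \<integral>x. g x * box_bump a b j x \<partial>lebesgue_on \<Omega>) \<longlonglongrightarrow> integral (cbox a b) g"
proof -
  have ai: "g absolutely_integrable_on cbox a b"
    using g sub by (auto simp: locally_integrable_on_def)
  then have int: "integrable lebesgue (\<lambda>x. indicator (cbox a b) x *\<^sub>R g x)"
    by (simp add: set_integrable_def)
  have mb: "box_bump a b j \<in> borel_measurable lebesgue" for j
    using Ck_on_UNIV_imp_continuous[OF Ck_on_UNIV_box_bump[of 0 a b j]]
    by (intro measurable_completion) (auto intro: borel_measurable_continuous_onI)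
  have mi: "indicator (box a b) \<in> borel_measurable (lebesgue :: (real^'n) measure)"
    by (intro measurable_completion) simp
  have eq: "(\<integral>x. g x * box_bump a b j x \<partial>lebesgue_on \<Omega>) = (\<integral>x. (indicator (cbox a b) x *\<^sub>R g x) * box_bump a b j x \<partial>lebesgue)" for j
  proof -
    have "(\<integral>x. g x * box_bump a b j x \<partial>lebesgue_on \<Omega>) = (\<integral>x. indicator \<Omega> x *\<^sub>R (g x * box_bump a b j x) \<partial>lebesgue)"
      using \<Omega> by (subst integral_restrict_space) auto
    also have "\<dots> = (\<integral>x. (indicator (cbox a b) x *\<^sub>R g x) * box_bump a b j x \<partial>lebesgue)"
    proof (rule Bochner_Integration.integral_cong[OF refl])
      fix x
      show "indicator \<Omega> x *\<^sub>R (g x * box_bump a b j x) = (indicator (cbox a b) x *\<^sub>R g x) * box_bump a b j x"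
        using sub box_bump_eq_0[of x a b j] box_subset_cbox[of a b]
        by (cases "x \<in> cbox a b") (auto simp: indicator_def)
    qed
    finally show ?thesis .
  qed
  have "(\<lambda>j. \<integral>x. (indicator (cbox a b) x *\<^sub>R g x) * box_bump a b j x \<partial>lebesgue)
     \<longlonglongrightarrow> (\<integral>x. (indicator (cbox a b) x *\<^sub>R g x) * indicator (box a b) x \<partial>lebesgue)"
  proof (rule integral_dominated_convergence)
    show "integrable lebesgue (\<lambda>x. norm (indicator (cbox a b) x *\<^sub>R g x))"
      using int by (rule integrable_norm)
    show "AE x in lebesgue. (\<lambda>j. (indicator (cbox a b) x *\<^sub>R g x) * box_bump a b j x)
      \<longlonglongrightarrow> (indicator (cbox a b) x *\<^sub>R g x) * indicator (box a b) x"
      by (intro AE_I2 tendsto_mult tendsto_const box_bump_tendsto)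
    show "AE x in lebesgue. norm ((indicator (cbox a b) x *\<^sub>R g x) * box_bump a b j x) \<le> norm (indicator (cbox a b) x *\<^sub>R g x)" for j
      using box_bump_bounds[of a b j] by (intro AE_I2) (auto simp: abs_mult intro!: mult_left_le)
    show "(\<lambda>x. (indicator (cbox a b) x *\<^sub>R g x) * indicator (box a b) x) \<in> borel_measurable lebesgue"
      by (rule borel_measurable_times[OF borel_measurable_integrable[OF int] mi])
    show "(\<lambda>x. (indicator (cbox a b) x *\<^sub>R g x) * box_bump a b j x) \<in> borel_measurable lebesgue" for j
      by (rule borel_measurable_times[OF borel_measurable_integrable[OF int] mb])
  qed
  also have "(\<integral>x. (indicator (cbox a b) x *\<^sub>R g x) * indicator (box a b) x \<partial>lebesgue) = (\<integral>x. indicator (cbox a b) x *\<^sub>R g x \<partial>lebesgue)"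
  proof (rule integral_cong_AE)
    have "AE x in lebesgue. x \<notin> cbox a b - box a b"
      by (intro AE_not_in null_sets_completionI null_sets_cbox_Diff_box)
    then show "AE x in lebesgue. (indicator (cbox a b) x *\<^sub>R g x) * indicator (box a b) x = indicator (cbox a b) x *\<^sub>R g x"
      by eventually_elim (auto simp: indicator_def)
  qed (rule borel_measurable_times[OF borel_measurable_integrable[OF int] mi] borel_measurable_integrable[OF int])+
  also have "\<dots> = integral (cbox a b) g"
    using set_lebesgue_integral_eq_integral(2)[OF ai] by (simp add: set_lebesgue_integral_def)
  finally show ?thesis unfolding eq .
qed

lemma locally_integrable_on_component:
  fixes g :: "real^'n::finite \<Rightarrow> real^'n"
  shows "locally_integrable_on g \<Omega> \<Longrightarrow> locally_integrable_on (\<lambda>x. g x $ i) \<Omega>"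
  unfolding locally_integrable_on_def
  using absolutely_integrable_component[where f=g and b="axis i 1"] by (auto simp: inner_axis)

text \<open>Pairing with bumps shows that the components of both gradients have equal integrals over
  every closed box in \<Omega>, so they agree almost everywhere on each such box. Countably many of
  these boxes cover the open set \<Omega>.\<close>

lemma weak_grad_unique:
  fixes g g' :: "real^'n::finite \<Rightarrow> real^'n"
  assumes \<Omega>: "open \<Omega>" and g: "is_weak_grad \<Omega> u g" and g': "is_weak_grad \<Omega> u g'"
  shows "AE x in lebesgue_on \<Omega>. g x = g' x"
proof -
  have [measurable]: "\<Omega> \<in> sets lebesgue" using \<Omega> by auto
  have L: "locally_integrable_on (\<lambda>x. g x $ i) \<Omega>" "locally_integrable_on (\<lambda>x. g' x $ i) \<Omega>" for i
    using g g' by (auto simp: is_weak_grad_def intro: locally_integrable_on_component)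
  have box_eq: "integral (cbox a b) (\<lambda>x. g x $ i) = integral (cbox a b) (\<lambda>x. g' x $ i)"
    if "cbox a b \<subseteq> \<Omega>" for a b i
  proof -
    have "(\<integral>x. g x $ i * box_bump a b j x \<partial>lebesgue_on \<Omega>) = (\<integral>x. g' x $ i * box_bump a b j x \<partial>lebesgue_on \<Omega>)" for j
    proof -
      have "(\<integral>x. u x * partial i (box_bump a b j) x \<partial>lebesgue_on \<Omega>) = - (\<integral>x. g x $ i * box_bump a b j x \<partial>lebesgue_on \<Omega>)"
        using g box_bump_test_function[OF that, of j] unfolding is_weak_grad_def by blast
      moreover have "(\<integral>x. u x * partial i (box_bump a b j) x \<partial>lebesgue_on \<Omega>) = - (\<integral>x. g' x $ i * box_bump a b j x \<partial>lebesgue_on \<Omega>)"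
        using g' box_bump_test_function[OF that, of j] unfolding is_weak_grad_def by blast
      ultimately show ?thesis by simp
    qed
    then have "(\<lambda>j. \<integral>x. g x $ i * box_bump a b j x \<partial>lebesgue_on \<Omega>) \<longlonglongrightarrow> integral (cbox a b) (\<lambda>x. g' x $ i)"
      using integral_lebesgue_on_box_bump_tendsto[OF L(2)[of i] _ that] by simp
    then show ?thesis
      using integral_lebesgue_on_box_bump_tendsto[OF L(1)[of i] _ that] LIMSEQ_unique by auto
  qed
  have neg: "negligible {x\<in>cbox a b. g x $ i - g' x $ i \<noteq> 0}" if ab: "cbox a b \<subseteq> \<Omega>" for a b i
  proof (rule negligible_nonzero_of_zero_box_integrals)
    have ai: "(\<lambda>x. g x $ i) absolutely_integrable_on cbox c d" "(\<lambda>x. g' x $ i) absolutely_integrable_on cbox c d"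
      if "cbox c d \<subseteq> \<Omega>" for c d
      using L[of i] that unfolding locally_integrable_on_def by auto
    show "(\<lambda>x. g x $ i - g' x $ i) absolutely_integrable_on cbox a b"
      using ai[OF ab] by (rule set_integral_diff)
    fix c d assume "cbox c d \<subseteq> cbox a b"
    then have cd: "cbox c d \<subseteq> \<Omega>" using ab by blast
    then show "integral (cbox c d) (\<lambda>x. g x $ i - g' x $ i) = 0"
      using box_eq[OF cd, of i] ai[OF cd]
      by (subst Henstock_Kurzweil_Integration.integral_diff)
         (auto intro: set_lebesgue_integral_eq_integral(1))
  qed
  obtain \<D> where \<D>: "countable \<D>" "\<D> \<subseteq> Pow \<Omega>" "\<And>X. X \<in> \<D> \<Longrightarrow> \<exists>a b. X = cbox a b" "\<Union>\<D> = \<Omega>"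
    using open_countable_Union_open_cbox[OF \<Omega>] by blast
  have "negligible (\<Union>X\<in>\<D>. \<Union>i\<in>UNIV. {x\<in>X. g x $ i - g' x $ i \<noteq> 0})"
  proof (rule negligible_countable_Union)
    show "countable ((\<lambda>X. \<Union>i\<in>UNIV. {x\<in>X. g x $ i - g' x $ i \<noteq> 0}) ` \<D>)" using \<D>(1) by simp
    fix T assume "T \<in> (\<lambda>X. \<Union>i\<in>UNIV. {x\<in>X. g x $ i - g' x $ i \<noteq> 0}) ` \<D>"
    then obtain X where X: "X \<in> \<D>" "T = (\<Union>i\<in>UNIV. {x\<in>X. g x $ i - g' x $ i \<noteq> 0})" by blast
    obtain a b where "X = cbox a b" using \<D>(3) X(1) by blast
    moreover have "X \<subseteq> \<Omega>" using \<D>(2) X(1) by blast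
    ultimately show "negligible T"
      unfolding X(2) using neg by (intro negligible_Union) auto
  qed
  then have "AE x in lebesgue. x \<notin> (\<Union>X\<in>\<D>. \<Union>i\<in>UNIV. {x\<in>X. g x $ i - g' x $ i \<noteq> 0})"
    by (intro AE_not_in) (simp add: negligible_iff_null_sets)
  then show ?thesis
  proof (subst AE_restrict_space_iff, simp, eventually_elim, intro impI)
    fix x assume x: "x \<notin> (\<Union>X\<in>\<D>. \<Union>i\<in>UNIV. {x\<in>X. g x $ i - g' x $ i \<noteq> 0})" "x \<in> \<Omega>"
    then obtain X where "X \<in> \<D>" "x \<in> X" using \<D>(4) by blast
    then have "g x $ i = g' x $ i" for i using x(1) by auto
    then show "g x = g' x" by (simp add: vec_eq_iff)
  qed
qed

section \<open>Exponential integrability in the Sobolev space\<close>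

text \<open>A bound for \<psi> times \<bar>f\<bar> on K is an integrable majorant. The fact is used
  to split the Bochner integral of a difference, which requires both parts to be integrable.\<close>

lemma integrable_mult_compact_support:
  fixes f \<psi> :: "real^'n::finite \<Rightarrow> real"
  assumes f: "locally_integrable_on f \<Omega>" and \<Omega>: "\<Omega> \<in> sets lebesgue"
    and K: "compact K" "K \<subseteq> \<Omega>" and \<psi>: "continuous_on UNIV \<psi>" "\<And>x. x \<notin> K \<Longrightarrow> \<psi> x = 0"
  shows "integrable (lebesgue_on \<Omega>) (\<lambda>x. f x * \<psi> x)"
proof -
  have "bounded {x. \<psi> x \<noteq> 0}"
    by (rule bounded_subset[OF compact_imp_bounded[OF K(1)]]) (use \<psi>(2) in blast)
  then obtain B where B: "\<And>x. \<bar>\<psi> x\<bar> \<le> B"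
    using continuous_bounded_support_bounded[OF \<psi>(1)] by blast
  have int: "integrable lebesgue (\<lambda>x. indicator K x *\<^sub>R f x)"
    using f K unfolding locally_integrable_on_def set_integrable_def by blast
  have m\<psi>: "\<psi> \<in> borel_measurable lebesgue"
    using \<psi>(1) by (intro measurable_completion) (auto intro: borel_measurable_continuous_onI)
  have "integrable lebesgue (\<lambda>x. (indicator K x *\<^sub>R f x) * \<psi> x)"
  proof (rule Bochner_Integration.integrable_bound)
    show "integrable lebesgue (\<lambda>x. (indicator K x *\<^sub>R f x) * B)" using int by (rule integrable_mult_left)
    show "(\<lambda>x. (indicator K x *\<^sub>R f x) * \<psi> x) \<in> borel_measurable lebesgue"
      by (rule borel_measurable_times[OF borel_measurable_integrable[OF int] m\<psi>])
    have "\<bar>\<psi> x\<bar> \<le> \<bar>B\<bar>" for x using B[of x] by simp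
    then show "AE x in lebesgue. norm ((indicator K x *\<^sub>R f x) * \<psi> x) \<le> norm ((indicator K x *\<^sub>R f x) * B)"
      by (auto simp: abs_mult mult_left_mono)
  qed
  also have "(\<lambda>x. (indicator K x *\<^sub>R f x) * \<psi> x) = (\<lambda>x. indicator \<Omega> x *\<^sub>R (f x * \<psi> x))"
    using \<psi>(2) K(2) by (auto simp: indicator_def fun_eq_iff)
  finally show ?thesis using \<Omega> by (subst integrable_restrict_space) auto
qed

lemma is_weak_grad_diff:
  assumes \<Omega>: "open \<Omega>" and u: "is_weak_grad \<Omega> u g" and v: "is_weak_grad \<Omega> v h"
  shows "is_weak_grad \<Omega> (\<lambda>x. u x - v x) (\<lambda>x. g x - h x)"
proof -
  have \<Omega>m: "\<Omega> \<in> sets lebesgue" using \<Omega> by auto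
  have L: "locally_integrable_on u \<Omega>" "locally_integrable_on v \<Omega>" "locally_integrable_on g \<Omega>" "locally_integrable_on h \<Omega>"
    using u v unfolding is_weak_grad_def by blast+
  have "(\<integral>x. (u x - v x) * partial i \<phi> x \<partial>lebesgue_on \<Omega>) = - (\<integral>x. (g x - h x) $ i * \<phi> x \<partial>lebesgue_on \<Omega>)"
    if \<phi>: "\<phi> \<in> test_functions \<Omega>" for \<phi> i
  proof -
    let ?K = "closure {x. \<phi> x \<noteq> 0}"
    have K: "compact ?K" "?K \<subseteq> \<Omega>" using \<phi> unfolding test_functions_def by blast+
    note t\<phi> = test_functionD[OF \<phi>]
    have z: "\<phi> x = 0" if "x \<notin> ?K" for x
      using that closure_subset[of "{x. \<phi> x \<noteq> 0}"] by blast
    have "integrable (lebesgue_on \<Omega>) (\<lambda>x. f x * partial i \<phi> x)" if "locally_integrable_on f \<Omega>" for f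
      by (rule integrable_mult_compact_support[OF that \<Omega>m K t\<phi>(3) partial_eq_0_outside])
    moreover have "integrable (lebesgue_on \<Omega>) (\<lambda>x. f x $ i * \<phi> x)" if "locally_integrable_on f \<Omega>" for f
      by (rule integrable_mult_compact_support[OF locally_integrable_on_component[OF that] \<Omega>m K t\<phi>(2) z])
    ultimately have "(\<integral>x. (u x - v x) * partial i \<phi> x \<partial>lebesgue_on \<Omega>) = 
        (\<integral>x. u x * partial i \<phi> x \<partial>lebesgue_on \<Omega>) - (\<integral>x. v x * partial i \<phi> x \<partial>lebesgue_on \<Omega>)"
      "(\<integral>x. (g x - h x) $ i * \<phi> x \<partial>lebesgue_on \<Omega>) = 
        (\<integral>x. g x $ i * \<phi> x \<partial>lebesgue_on \<Omega>) - (\<integral>x. h x $ i * \<phi> x \<partial>lebesgue_on \<Omega>)"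
      using L by (simp_all add: left_diff_distrib)
    then show ?thesis using u v \<phi> unfolding is_weak_grad_def by simp
  qed
  moreover have "locally_integrable_on (\<lambda>x. u x - v x) \<Omega>" "locally_integrable_on (\<lambda>x. g x - h x) \<Omega>"
    using L unfolding locally_integrable_on_def by (auto intro: set_integral_diff(1))
  ultimately show ?thesis unfolding is_weak_grad_def by blast
qed

text \<open>The norm of a - b is at most twice the larger of the two norms, and the p-th power of a
  maximum is at most the sum of the p-th powers. The crude constant serves three purposes: closure
  of Lp under differences, the energy of differences, and, with p = n / (n - 1), splitting the
  exponent.\<close>

lemma powr_norm_diff_le:
  fixes a b :: "'b::real_normed_vector"
  assumes p: "p > 0"
  shows "norm (a - b) powr p \<le> 2 powr p * (norm a powr p + norm b powr p)"
proof -
  have "norm (a - b) \<le> 2 * max (norm a) (norm b)"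
    using norm_triangle_ineq4[of a b] by linarith
  then have "norm (a - b) powr p \<le> (2 * max (norm a) (norm b)) powr p"
    using p by (intro powr_mono2) auto
  also have "\<dots> = 2 powr p * max (norm a) (norm b) powr p" by (simp add: powr_mult)
  also have "max (norm a) (norm b) powr p \<le> norm a powr p + norm b powr p"
    by (simp add: max_def)
  finally show ?thesis by simp
qed

lemma Lp_on_diff:
  fixes f g :: "real^'n::finite \<Rightarrow> 'b::euclidean_space"
  assumes p: "p > 0" and f: "f \<in> Lp_on p \<Omega>" and g: "g \<in> Lp_on p \<Omega>"
  shows "(\<lambda>x. f x - g x) \<in> Lp_on p \<Omega>"
proof -
  have m [measurable]: "f \<in> borel_measurable (lebesgue_on \<Omega>)" "g \<in> borel_measurable (lebesgue_on \<Omega>)"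
    and int: "integrable (lebesgue_on \<Omega>) (\<lambda>x. norm (f x) powr p)" "integrable (lebesgue_on \<Omega>) (\<lambda>x. norm (g x) powr p)"
    using f g unfolding Lp_on_def by auto
  have "integrable (lebesgue_on \<Omega>) (\<lambda>x. norm (f x - g x) powr p)"
  proof (rule Bochner_Integration.integrable_bound)
    show "integrable (lebesgue_on \<Omega>) (\<lambda>x. 2 powr p * (norm (f x) powr p + norm (g x) powr p))"
      by (intro integrable_mult_right Bochner_Integration.integrable_add int)
    show "AE x in lebesgue_on \<Omega>. norm (norm (f x - g x) powr p) \<le> norm (2 powr p * (norm (f x) powr p + norm (g x) powr p))"
      using powr_norm_diff_le[OF p, of "f _" "g _"] by auto
  qed measurable
  then show ?thesis unfolding Lp_on_def by simp
qed

lemma Lp_on_continuous_bounded_support: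
  fixes f :: "real^'n::finite \<Rightarrow> 'b::euclidean_space"
  assumes p: "p > 0" and \<Omega>: "\<Omega> \<in> sets lebesgue"
    and f: "continuous_on UNIV f" "bounded {x. f x \<noteq> 0}"
  shows "f \<in> Lp_on p \<Omega>"
proof -
  have "bounded {x. norm (f x) powr p \<noteq> 0}" using f(2) by simp
  moreover have "continuous_on UNIV (\<lambda>x. norm (f x) powr p)"
    using p f(1) by (intro continuous_on_powr' continuous_intros) auto
  ultimately have int: "integrable lborel (\<lambda>x. norm (f x) powr p)"
    by (intro integrable_continuous_bounded_support)
  then have "integrable lebesgue (\<lambda>x. norm (f x) powr p)"
    by (subst integrable_completion) (auto dest: borel_measurable_integrable)
  then have "integrable (lebesgue_on \<Omega>) (\<lambda>x. norm (f x) powr p)"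
    using \<Omega> integrable_mult_indicator[of \<Omega> lebesgue "\<lambda>x. norm (f x) powr p"]
    by (simp add: integrable_restrict_space)
  moreover have "f \<in> borel_measurable (lebesgue_on \<Omega>)"
    using f(1) by (intro measurable_restrict_space1 measurable_completion) (auto intro: borel_measurable_continuous_onI)
  ultimately show ?thesis unfolding Lp_on_def by simp
qed

lemma bounded_support_grad:
  fixes f :: "real^'n::finite \<Rightarrow> real"
  assumes "bounded {x. f x \<noteq> 0}"
  shows "bounded {x. grad f x \<noteq> 0}"
  by (rule bounded_subset[OF bounded_closure[OF assms]])
     (auto simp: grad_def vec_eq_iff intro: ccontr dest: partial_eq_0_outside)

text \<open>Rests on completeness of Lebesgue measure, after extending both functions by 0. It makes
  the weak gradient picked by choice measurable once it is known to agree almost everywhere with a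
  measurable one.\<close>

lemma borel_measurable_lebesgue_on_AE:
  fixes f g :: "'a::euclidean_space \<Rightarrow> 'b::euclidean_space"
  assumes \<Omega>: "\<Omega> \<in> sets lebesgue" and f: "f \<in> borel_measurable (lebesgue_on \<Omega>)"
    and ae: "AE x in lebesgue_on \<Omega>. g x = f x"
  shows "g \<in> borel_measurable (lebesgue_on \<Omega>)"
proof -
  have m: "(\<lambda>x. if x \<in> \<Omega> then f x else 0) \<in> borel_measurable lebesgue"
    using f by (rule borel_measurable_if_I[OF _ \<Omega>])
  have "AE x in lebesgue. (if x \<in> \<Omega> then f x else 0) = (if x \<in> \<Omega> then g x else 0)"
  proof -
    have "AE x in lebesgue. x \<in> \<Omega> \<longrightarrow> g x = f x"
      using ae \<Omega> by (simp add: AE_restrict_space_iff)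
    then show ?thesis by eventually_elim simp
  qed
  then have "(\<lambda>x. if x \<in> \<Omega> then g x else 0) \<in> borel_measurable lebesgue"
    by (rule borel_measurable_AE[OF m])
  then show ?thesis by (rule borel_measurable_if_D)
qed

text \<open>\<^const>\<open>sobolev_norm\<close> contains an arbitrarily chosen weak gradient, whose integral would be the junk
  value 0 if it were not integrable; uniqueness identifies it with \<open>g - grad (\<phi> k)\<close>.\<close>

lemma sobolev0_approximation:
  fixes u :: "real^'n::finite \<Rightarrow> real"
  assumes p: "p > 0" and \<Omega>: "open \<Omega>" and u: "u \<in> sobolev0 p \<Omega>"
  obtains g \<phi> where "\<And>k. \<phi> k \<in> test_functions \<Omega>"
    "\<And>k. (\<lambda>x. u x - \<phi> k x) \<in> Lp_on p \<Omega>" "\<And>k. (\<lambda>x. g x - grad (\<phi> k) x) \<in> Lp_on p \<Omega>"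
    "(\<lambda>k. \<integral>x. \<bar>u x - \<phi> k x\<bar> powr p \<partial>lebesgue_on \<Omega>) \<longlonglongrightarrow> 0"
    "(\<lambda>k. \<integral>x. norm (g x - grad (\<phi> k) x) powr p \<partial>lebesgue_on \<Omega>) \<longlonglongrightarrow> 0"
proof -
  have \<Omega>m: "\<Omega> \<in> sets lebesgue" using \<Omega> by auto
  obtain g where g: "is_weak_grad \<Omega> u g" "g \<in> Lp_on p \<Omega>" and uL: "u \<in> Lp_on p \<Omega>"
    using u unfolding sobolev0_def sobolev_def by blast
  obtain \<phi> where \<phi>: "\<And>k::nat. \<phi> k \<in> test_functions \<Omega>"
    and lim: "(\<lambda>k. sobolev_norm p \<Omega> (\<lambda>x. u x - \<phi> k x)) \<longlonglongrightarrow> 0"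
    using u unfolding sobolev0_def by blast
  note t\<phi> = test_functionD[OF \<phi>]
  have uL': "(\<lambda>x. u x - \<phi> k x) \<in> Lp_on p \<Omega>" for k
    by (intro Lp_on_diff p uL Lp_on_continuous_bounded_support \<Omega>m t\<phi>)
  have gL': "(\<lambda>x. g x - grad (\<phi> k) x) \<in> Lp_on p \<Omega>" for k
    by (intro Lp_on_diff p g(2) Lp_on_continuous_bounded_support \<Omega>m bounded_support_grad continuous_on_grad t\<phi>)
  define A where "A k = (\<integral>x. \<bar>u x - \<phi> k x\<bar> powr p \<partial>lebesgue_on \<Omega>)" for k
  define B where "B k = (\<integral>x. norm (g x - grad (\<phi> k) x) powr p \<partial>lebesgue_on \<Omega>)" for k
  have nn: "A k \<ge> 0" "B k \<ge> 0" for k unfolding A_def B_def by simp_all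
  have norm_eq: "sobolev_norm p \<Omega> (\<lambda>x. u x - \<phi> k x) = (A k + B k) powr (1 / p)" for k
  proof -
    let ?w = "weak_grad \<Omega> (\<lambda>x. u x - \<phi> k x)"
    have G: "is_weak_grad \<Omega> (\<lambda>x. u x - \<phi> k x) (\<lambda>x. g x - grad (\<phi> k) x)"
      by (intro is_weak_grad_diff \<Omega> g(1) is_weak_grad_test_function \<phi>)
    then have "is_weak_grad \<Omega> (\<lambda>x. u x - \<phi> k x) ?w"
      unfolding weak_grad_def by (rule someI[of "is_weak_grad \<Omega> (\<lambda>x. u x - \<phi> k x)"])
    then have ae: "AE x in lebesgue_on \<Omega>. ?w x = g x - grad (\<phi> k) x"
      using weak_grad_unique[OF \<Omega> _ G] by blast
    have "(\<integral>x. norm (?w x) powr p \<partial>lebesgue_on \<Omega>) = B k"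
    proof -
      have m: "(\<lambda>x. g x - grad (\<phi> k) x) \<in> borel_measurable (lebesgue_on \<Omega>)"
        using gL'[of k] unfolding Lp_on_def by blast
      then have wm: "?w \<in> borel_measurable (lebesgue_on \<Omega>)"
        using ae by (rule borel_measurable_lebesgue_on_AE[OF \<Omega>m])
      show ?thesis unfolding B_def using m wm ae
        by (intro integral_cong_AE) auto
    qed
    then show ?thesis unfolding sobolev_norm_def A_def by simp
  qed
  have "(\<lambda>k. ((A k + B k) powr (1 / p)) powr p) \<longlonglongrightarrow> 0 powr p"
    using lim p unfolding norm_eq by (intro tendsto_powr') auto
  then have S: "(\<lambda>k. A k + B k) \<longlonglongrightarrow> 0" using p nn by (simp add: powr_powr)
  have "A \<longlonglongrightarrow> 0" "B \<longlonglongrightarrow> 0"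
    using nn by (auto intro!: tendsto_sandwich[OF _ _ tendsto_const S] always_eventually)
  then show ?thesis unfolding A_def[abs_def] B_def[abs_def] by (rule that[of \<phi> g, OF \<phi> uL' gL'])
qed

section \<open>Trudinger's inequality and the passage to the limit\<close>

text \<open>The difference V of the gradients supplies all directional derivatives, and
  \<open>norm (V x)\<close> dominates each of them. Since V vanishes outside \<Omega>, the energy
  over \<Omega> is the energy over the whole space.\<close>

theorem Trudinger_test_function_diff:
  fixes \<phi> \<psi> :: "real^'n::finite \<Rightarrow> real"
  assumes n: "CARD('n) \<ge> 2" and \<Omega>: "open \<Omega>" "bounded \<Omega>"
    and \<phi>: "\<phi> \<in> test_functions \<Omega>" and \<psi>: "\<psi> \<in> test_functions \<Omega>"
    and E: "(\<integral>\<^sup>+x. ennreal (norm (grad \<phi> x - grad \<psi> x) ^ CARD('n)) \<partial>lebesgue_on \<Omega>) \<le> ennreal K" and K: "K > 0"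
  shows "(\<integral>\<^sup>+ x. ennreal (exp ((\<bar>\<phi> x - \<psi> x\<bar> / (2 * root CARD('n) K)) powr (CARD('n) / (CARD('n) - 1)) / 2)) \<partial>lebesgue_on \<Omega>)
    \<le> ennreal (exp (1/2) / (1 - exp (1/2) / 2)) * emeasure lborel \<Omega>"
proof -
  note t\<phi> = test_functionD[OF \<phi>] and t\<psi> = test_functionD[OF \<psi>]
  have [measurable]: "\<Omega> \<in> sets borel" "\<Omega> \<in> sets lebesgue" using \<Omega> by auto
  define V where "V x = grad \<phi> x - grad \<psi> x" for x
  have cV: "continuous_on UNIV V"
    unfolding V_def by (intro continuous_on_diff continuous_on_grad t\<phi> t\<psi>)
  have V0: "V x = 0" if "x \<notin> \<Omega>" for x
    using that t\<phi>(7) t\<psi>(7) by (simp add: V_def grad_def vec_eq_iff)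
  have restr: "(\<integral>\<^sup>+x. f x \<partial>lebesgue_on \<Omega>) = (\<integral>\<^sup>+x\<in>\<Omega>. f x \<partial>lborel)" for f
    by (simp add: nn_integral_restrict_space nn_integral_completion)
  have "(\<integral>\<^sup>+ x\<in>\<Omega>. ennreal (exp ((\<bar>\<phi> x - \<psi> x\<bar> / (2 * root DIM(real^'n) K)) powr (DIM(real^'n) / (DIM(real^'n) - 1)) / 2)) \<partial>lborel)
    \<le> ennreal (exp (1/2) / (1 - exp (1/2) / 2)) * emeasure lborel \<Omega>"
  proof (rule Trudinger_C1[where D="\<lambda>b x. V x \<bullet> b" and G="\<lambda>x. norm (V x)"])
    show "2 \<le> DIM(real^'n)" using n by simp
    show "((\<lambda>s. \<phi> (x + s *\<^sub>R b) - \<psi> (x + s *\<^sub>R b)) has_real_derivative V (x + s *\<^sub>R b) \<bullet> b) (at s)"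
      if bB: "b \<in> Basis" for b x s
    proof -
      obtain i where b: "b = axis i 1" using bB by (auto simp: Basis_vec_def)
      show ?thesis unfolding b V_def
        using DERIV_diff[OF differentiable_imp_DERIV_partial differentiable_imp_DERIV_partial, of \<phi> x s i \<psi>, OF t\<phi>(1) t\<psi>(1)]
        by (simp add: inner_axis grad_def)
    qed
    show "continuous_on UNIV (\<lambda>x. V x \<bullet> b)" for b
      by (intro continuous_on_inner cV continuous_on_const)
    show "continuous_on UNIV (\<lambda>x. \<phi> x - \<psi> x)"
      by (intro continuous_on_diff t\<phi> t\<psi>)
    show "{x. \<phi> x - \<psi> x \<noteq> 0} \<subseteq> \<Omega>" using t\<phi>(6) t\<psi>(6) by fastforce
    show "(\<lambda>x. norm (V x)) \<in> borel_measurable borel"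
      using cV by (intro borel_measurable_continuous_onI continuous_on_norm)
    show "\<bar>V x \<bullet> b\<bar> \<le> norm (V x)" if "b \<in> Basis" for b x
      using that by (rule Basis_le_norm)
    have "(\<integral>\<^sup>+x. ennreal (norm (V x) ^ DIM(real^'n)) \<partial>lborel) = (\<integral>\<^sup>+x\<in>\<Omega>. ennreal (norm (V x) ^ CARD('n)) \<partial>lborel)"
      using V0 n by (intro nn_integral_cong) (auto simp: indicator_def power_0_left)
    then show "(\<integral>\<^sup>+x. ennreal (norm (V x) ^ DIM(real^'n)) \<partial>lborel) \<le> ennreal K"
      using E by (simp add: restr V_def)
  qed (use \<Omega> K in auto)
  then show ?thesis by (simp add: restr)
qed

theorem sobolev0_exp_integrable:
  fixes u :: "real^'n::finite \<Rightarrow> real"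
  assumes n: "CARD('n) \<ge> 2" and \<Omega>: "open \<Omega>" "bounded \<Omega>"
    and u: "u \<in> sobolev0 CARD('n) \<Omega>" and \<gamma>: "\<gamma> \<ge> 0"
  shows "(\<integral>\<^sup>+ x. ennreal (exp (\<gamma> * \<bar>u x\<bar> powr (CARD('n) / (real CARD('n) - 1)))) \<partial>lebesgue_on \<Omega>) < \<infinity>"
proof -
  define N where "N = CARD('n)"
  define q where "q = N / (real N - 1)"
  have N: "N \<ge> 2" "real N > 0" using n unfolding N_def by auto
  have q: "q > 0" using N unfolding q_def by simp
  \<comment> \<open>Trudinger's inequality above has the exponent with subtraction of natural
    numbers in the denominator; the two readings agree since N \<ge> 2.\<close>
  have q': "real N / real (N - 1) = q" using N by (simp add: q_def of_nat_diff)
  obtain g \<phi> where \<phi>: "\<And>k. \<phi> k \<in> test_functions \<Omega>"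
    and uL: "\<And>k. (\<lambda>x. u x - \<phi> k x) \<in> Lp_on N \<Omega>" and gL: "\<And>k. (\<lambda>x. g x - grad (\<phi> k) x) \<in> Lp_on N \<Omega>"
    and ulim: "(\<lambda>k. \<integral>x. \<bar>u x - \<phi> k x\<bar> powr N \<partial>lebesgue_on \<Omega>) \<longlonglongrightarrow> 0"
    and glim: "(\<lambda>k. \<integral>x. norm (g x - grad (\<phi> k) x) powr N \<partial>lebesgue_on \<Omega>) \<longlonglongrightarrow> 0"
    by (rule sobolev0_approximation[OF N(2) \<Omega>(1) u[folded N_def]]) (rule that)
  note t\<phi> = test_functionD[OF \<phi>]
  have \<Omega>m [measurable]: "\<Omega> \<in> sets lebesgue" using \<Omega> by auto
  have m\<phi> [measurable]: "\<phi> k \<in> borel_measurable (lebesgue_on \<Omega>)" for k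
    using t\<phi>(2) by (intro measurable_restrict_space1 measurable_completion) (auto intro: borel_measurable_continuous_onI)
  have [measurable]: "u \<in> borel_measurable (lebesgue_on \<Omega>)"
    using u unfolding sobolev0_def sobolev_def Lp_on_def by blast
  \<comment> \<open>The constant in the splitting of \<bar>u\<bar>^q into \<bar>u - \<phi> m\<bar>^q
    and \<bar>\<phi> m\<bar>^q.\<close>
  define c where "c = 2 powr q"
  have c: "c > 0" unfolding c_def by simp
  \<comment> \<open>Chosen so that (t / (2 r))^q / 2 = (\<gamma> c + 1/2) t^q, which dominates
    \<gamma> c t^q. The summand 1 keeps the denominator positive for \<gamma> = 0.\<close>
  define r where "r = (1 / (2 * \<gamma> * c + 1)) powr (1 / q) / 2"
  have pos: "2 * \<gamma> * c + 1 > 0" using \<gamma> c by (simp add: add_nonneg_pos)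
  have r: "r > 0" unfolding r_def using pos by simp
  have rq: "(2 * r) powr q = 1 / (2 * \<gamma> * c + 1)"
    unfolding r_def using pos q by (simp add: powr_powr)
  define \<eta> where "\<eta> = r ^ N"
  have \<eta>: "\<eta> > 0" "root N \<eta> = r" unfolding \<eta>_def using r N by (auto simp: real_root_power_cancel)
  \<comment> \<open>The energy of \<open>\<phi> k - \<phi> m\<close> is at most 2^N times a sum of
    two such errors, hence at most \<eta>; and the N-th root of \<eta> is r.\<close>
  have "\<eta> / (2 * 2 ^ N) > 0" using \<eta> by simp
  from order_tendstoD(2)[OF glim this] obtain m where 
    m: "\<And>k. k \<ge> m \<Longrightarrow> (\<integral>x. norm (g x - grad (\<phi> k) x) powr N \<partial>lebesgue_on \<Omega>) < \<eta> / (2 * 2 ^ N)"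
    unfolding eventually_sequentially by blast
  define B where "B = ennreal (exp (1/2) / (1 - exp (1/2) / 2)) * emeasure lborel \<Omega>"
  have B: "B < \<infinity>"
    using emeasure_bounded_finite[OF \<Omega>(2)] unfolding B_def by (simp add: ennreal_mult_less_top)
  have energy: "(\<integral>\<^sup>+x. ennreal (norm (grad (\<phi> k) x - grad (\<phi> m) x) ^ N) \<partial>lebesgue_on \<Omega>) \<le> ennreal \<eta>"
    if k: "k \<ge> m" for k
  proof -
    let ?a = "\<lambda>k x. norm (g x - grad (\<phi> k) x) powr N"
    have int: "integrable (lebesgue_on \<Omega>) (?a k)" for k
      using gL unfolding Lp_on_def by blast
    have "(\<integral>\<^sup>+x. ennreal (norm (grad (\<phi> k) x - grad (\<phi> m) x) ^ N) \<partial>lebesgue_on \<Omega>)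
       \<le> (\<integral>\<^sup>+x. ennreal (2 ^ N * (?a k x + ?a m x)) \<partial>lebesgue_on \<Omega>)"
    proof (intro nn_integral_mono ennreal_leI)
      fix x
      show "norm (grad (\<phi> k) x - grad (\<phi> m) x) ^ N \<le> 2 ^ N * (?a k x + ?a m x)"
        using powr_norm_diff_le[OF N(2), of "g x - grad (\<phi> m) x" "g x - grad (\<phi> k) x"] N
        by (simp add: powr_realpow' powr_realpow add.commute)
    qed
    also have "\<dots> = ennreal (\<integral>x. 2 ^ N * (?a k x + ?a m x) \<partial>lebesgue_on \<Omega>)"
      by (intro nn_integral_eq_integral integrable_mult_right Bochner_Integration.integrable_add int) auto
    also have "(\<integral>x. 2 ^ N * (?a k x + ?a m x) \<partial>lebesgue_on \<Omega>) 
        = 2 ^ N * ((\<integral>x. ?a k x \<partial>lebesgue_on \<Omega>) + (\<integral>x. ?a m x \<partial>lebesgue_on \<Omega>))"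
      using int by simp
    also have "\<dots> \<le> 2 ^ N * (\<eta> / (2 * 2 ^ N) + \<eta> / (2 * 2 ^ N))"
      using m[OF k] m[of m] by (intro mult_left_mono add_mono) auto
    also have "\<dots> = \<eta>" by simp
    finally show ?thesis by (simp add: ennreal_leI)
  qed
  have exp_bound: "(\<integral>\<^sup>+ x. ennreal (exp (\<gamma> * c * \<bar>\<phi> k x - \<phi> m x\<bar> powr q)) \<partial>lebesgue_on \<Omega>) \<le> B" if k: "k \<ge> m" for k
  proof -
    have "(\<integral>\<^sup>+ x. ennreal (exp (\<gamma> * c * \<bar>\<phi> k x - \<phi> m x\<bar> powr q)) \<partial>lebesgue_on \<Omega>)
       \<le> (\<integral>\<^sup>+ x. ennreal (exp ((\<bar>\<phi> k x - \<phi> m x\<bar> / (2 * root N \<eta>)) powr (real N / real (N - 1)) / 2)) \<partial>lebesgue_on \<Omega>)"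
    proof (intro nn_integral_mono ennreal_leI)
      fix x
      let ?t = "\<bar>\<phi> k x - \<phi> m x\<bar>"
      have "(?t / (2 * r)) powr q = ?t powr q * (2 * \<gamma> * c + 1)"
        using r by (simp add: powr_divide rq)
      then have "\<gamma> * c * ?t powr q \<le> (?t / (2 * r)) powr q / 2" by (simp add: algebra_simps)
      then show "exp (\<gamma> * c * ?t powr q) \<le> exp ((?t / (2 * root N \<eta>)) powr (real N / real (N - 1)) / 2)"
        unfolding \<eta>(2) q' by simp
    qed
    also have "\<dots> \<le> B"
      unfolding B_def N_def by (rule Trudinger_test_function_diff[OF n \<Omega> \<phi> \<phi>])
        (use energy[OF k] \<eta> in \<open>auto simp: N_def\<close>)
    finally show ?thesis .
  qed
  \<comment> \<open>Convergence in L^N is convergence to 0 in L^1 of the N-th powers of the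
    differences, so a subsequence converges almost everywhere, as Fatou's lemma requires.\<close>
  have "integrable (lebesgue_on \<Omega>) (\<lambda>x. \<bar>u x - \<phi> k x\<bar> powr N)" for k
    using uL unfolding Lp_on_def by simp
  moreover have "(\<lambda>k. \<integral>x. norm (\<bar>u x - \<phi> k x\<bar> powr N) \<partial>lebesgue_on \<Omega>) \<longlonglongrightarrow> 0"
    using ulim by simp
  ultimately obtain s :: "nat \<Rightarrow> nat" where s: "strict_mono s"
    and ae: "AE x in lebesgue_on \<Omega>. (\<lambda>k. \<bar>u x - \<phi> (s k) x\<bar> powr N) \<longlonglongrightarrow> 0"
    using tendsto_L1_AE_subseq[of "lebesgue_on \<Omega>" "\<lambda>k x. \<bar>u x - \<phi> k x\<bar> powr N"] by blast
  have "(\<integral>\<^sup>+ x. ennreal (exp (\<gamma> * c * \<bar>u x - \<phi> m x\<bar> powr q)) \<partial>lebesgue_on \<Omega>)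
     \<le> (\<integral>\<^sup>+ x. liminf (\<lambda>k. ennreal (exp (\<gamma> * c * \<bar>\<phi> (s k) x - \<phi> m x\<bar> powr q))) \<partial>lebesgue_on \<Omega>)"
  proof (rule nn_integral_mono_AE, use ae in eventually_elim)
    case (elim x)
    have "(\<lambda>k. (\<bar>u x - \<phi> (s k) x\<bar> powr N) powr (1 / N)) \<longlonglongrightarrow> 0 powr (1 / N)"
      using N by (intro tendsto_powr'[OF elim tendsto_const]) auto
    then have "(\<lambda>k. \<bar>u x - \<phi> (s k) x\<bar>) \<longlonglongrightarrow> 0" using N by (simp add: powr_powr)
    then have "(\<lambda>k. u x - \<phi> (s k) x) \<longlonglongrightarrow> 0" by (rule tendsto_rabs_zero_cancel)
    then have "(\<lambda>k. u x - (u x - \<phi> (s k) x)) \<longlonglongrightarrow> u x - 0" by (intro tendsto_diff tendsto_const)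
    then have l: "(\<lambda>k. \<phi> (s k) x) \<longlonglongrightarrow> u x" by simp
    have "(\<lambda>k. ennreal (exp (\<gamma> * c * \<bar>\<phi> (s k) x - \<phi> m x\<bar> powr q))) \<longlonglongrightarrow> ennreal (exp (\<gamma> * c * \<bar>u x - \<phi> m x\<bar> powr q))"
      using q by (intro tendsto_ennrealI tendsto_exp tendsto_mult tendsto_const tendsto_powr' tendsto_rabs tendsto_diff l) auto
    then have "liminf (\<lambda>k. ennreal (exp (\<gamma> * c * \<bar>\<phi> (s k) x - \<phi> m x\<bar> powr q))) = ennreal (exp (\<gamma> * c * \<bar>u x - \<phi> m x\<bar> powr q))"
      by (intro lim_imp_Liminf) auto
    then show ?case by simp
  qed
  also have "\<dots> \<le> liminf (\<lambda>k. \<integral>\<^sup>+ x. ennreal (exp (\<gamma> * c * \<bar>\<phi> (s k) x - \<phi> m x\<bar> powr q)) \<partial>lebesgue_on \<Omega>)"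
    by (intro nn_integral_liminf) measurable
  also have "\<dots> \<le> liminf (\<lambda>k::nat. B)"
  proof (rule Liminf_mono)
    show "\<forall>\<^sub>F k in sequentially. (\<integral>\<^sup>+ x. ennreal (exp (\<gamma> * c * \<bar>\<phi> (s k) x - \<phi> m x\<bar> powr q)) \<partial>lebesgue_on \<Omega>) \<le> B"
      using eventually_ge_at_top[of m]
    proof eventually_elim
      case (elim k)
      then show ?case using exp_bound[of "s k"] seq_suble[OF s, of k] by simp
    qed
  qed
  also have "\<dots> = B" by (simp add: Liminf_const)
  finally have fin: "(\<integral>\<^sup>+ x. ennreal (exp (\<gamma> * c * \<bar>u x - \<phi> m x\<bar> powr q)) \<partial>lebesgue_on \<Omega>) \<le> B" .
  \<comment> \<open>The fixed test function is bounded, so restoring it costs only the factor exp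
    (\<gamma> c b^q).\<close>
  obtain b where b: "\<And>x. \<bar>\<phi> m x\<bar> \<le> b"
    using continuous_bounded_support_bounded[OF t\<phi>(2) t\<phi>(4)] by blast
  have "(\<integral>\<^sup>+ x. ennreal (exp (\<gamma> * \<bar>u x\<bar> powr q)) \<partial>lebesgue_on \<Omega>)
    \<le> (\<integral>\<^sup>+ x. ennreal (exp (\<gamma> * c * b powr q)) * ennreal (exp (\<gamma> * c * \<bar>u x - \<phi> m x\<bar> powr q)) \<partial>lebesgue_on \<Omega>)"
  proof (rule nn_integral_mono)
    fix x
    have "\<bar>u x\<bar> powr q \<le> c * (\<bar>u x - \<phi> m x\<bar> powr q + \<bar>\<phi> m x\<bar> powr q)"
      using powr_norm_diff_le[OF q, of "u x - \<phi> m x" "- \<phi> m x"] unfolding c_def by simp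
    also have "\<bar>\<phi> m x\<bar> powr q \<le> b powr q" using b q by (intro powr_mono2) auto
    finally have "\<bar>u x\<bar> powr q \<le> c * (\<bar>u x - \<phi> m x\<bar> powr q + b powr q)" using c by simp
    then have "\<gamma> * \<bar>u x\<bar> powr q \<le> \<gamma> * (c * (\<bar>u x - \<phi> m x\<bar> powr q + b powr q))" using \<gamma> by (rule mult_left_mono)
    then have "exp (\<gamma> * \<bar>u x\<bar> powr q) \<le> exp (\<gamma> * c * b powr q) * exp (\<gamma> * c * \<bar>u x - \<phi> m x\<bar> powr q)"
      by (simp add: mult_exp_exp algebra_simps)
    then show "ennreal (exp (\<gamma> * \<bar>u x\<bar> powr q)) \<le> ennreal (exp (\<gamma> * c * b powr q)) * ennreal (exp (\<gamma> * c * \<bar>u x - \<phi> m x\<bar> powr q))"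
      by (simp add: ennreal_mult'[symmetric] ennreal_leI)
  qed
  also have "\<dots> = ennreal (exp (\<gamma> * c * b powr q)) * (\<integral>\<^sup>+ x. ennreal (exp (\<gamma> * c * \<bar>u x - \<phi> m x\<bar> powr q)) \<partial>lebesgue_on \<Omega>)"
    by (intro nn_integral_cmult) measurable
  also have "\<dots> \<le> ennreal (exp (\<gamma> * c * b powr q)) * B" using fin by (rule mult_left_mono) simp
  also have "\<dots> < \<infinity>" using B by (simp add: ennreal_mult_less_top)
  finally show ?thesis unfolding q_def N_def .
qed

section \<open>The polar of a Finsler norm\<close>

lemma frechet_derivative_eq_sum_partial:
  fixes F :: "real^'n::finite \<Rightarrow> real"
  assumes "F differentiable at x"
  shows "frechet_derivative F (at x) v = (\<Sum>i\<in>UNIV. v $ i * partial i F x)"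
proof -
  have lin: "linear (frechet_derivative F (at x))" using assms by (rule linear_frechet_derivative)
  have "frechet_derivative F (at x) v = frechet_derivative F (at x) (\<Sum>i\<in>UNIV. v $ i *\<^sub>R axis i 1)"
    using basis_expansion[of v] by (simp add: scalar_mult_eq_scaleR)
  also have "\<dots> = (\<Sum>i\<in>UNIV. v $ i * partial i F x)"
    by (simp add: linear_sum[OF lin] linear_scale[OF lin] partial_def)
  finally show ?thesis .
qed

lemma finsler_normD:
  assumes "strongly_convex_finsler_norm F"
  shows "0 \<le> F \<xi>" "F (- \<xi>) = F \<xi>" "t > 0 \<Longrightarrow> F (t *\<^sub>R \<xi>) = t * F \<xi>" "Ck_on 2 (- {0}) F"
  using assms unfolding strongly_convex_finsler_norm_def by blast+

text \<open>If F \<xi> = 0, the Hessian of F^2 at \<xi> reduces to twice the product of first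
  derivatives of F. Euler's relation for the 1-homogeneous F says that the derivative at \<xi> in
  direction \<xi> is F \<xi> = 0, so the quadratic form vanishes at \<xi> and is not positive
  definite.\<close>

lemma finsler_norm_pos:
  fixes F :: "real^'n::finite \<Rightarrow> real"
  assumes F: "strongly_convex_finsler_norm F" and \<xi>: "\<xi> \<noteq> 0"
  shows "F \<xi> > 0"
proof (rule ccontr)
  assume "\<not> F \<xi> > 0"
  moreover have "F \<xi> \<ge> 0" by (rule finsler_normD(1)[OF F])
  ultimately have F0: "F \<xi> = 0" by simp
  note hom = finsler_normD(3)[OF F] and C2 = finsler_normD(4)[OF F]
  have d1: "F differentiable at \<eta>" "partial j F differentiable at \<eta>" if "\<eta> \<noteq> 0" for \<eta> j
    using C2 that by (auto simp: numeral_2_eq_2)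
  let ?f = "\<lambda>\<eta>. (F \<eta>)\<^sup>2"
  have p1: "partial j ?f \<eta> = 2 * (F \<eta> * partial j F \<eta>)" if "\<eta> \<noteq> 0" for \<eta> j
    using partial_mult[OF d1(1)[OF that] d1(1)[OF that], of j] by (simp add: power2_eq_square)
  \<comment> \<open>The term with second derivatives of F carries the factor F \<xi> and drops
    out.\<close>
  have p2: "partial i (partial j ?f) \<xi> = 2 * (partial i F \<xi> * partial j F \<xi>)" for i j
  proof -
    have "((\<lambda>\<eta>. 2 * (F \<eta> * partial j F \<eta>)) has_derivative
       (\<lambda>v. 2 * (F \<xi> * frechet_derivative (partial j F) (at \<xi>) v + frechet_derivative F (at \<xi>) v * partial j F \<xi>))) (at \<xi>)"
      by (intro has_derivative_mult_right has_derivative_mult differentiable_imp_has_derivative_frechet d1 \<xi>)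
    then have "(partial j ?f has_derivative
       (\<lambda>v. 2 * (F \<xi> * frechet_derivative (partial j F) (at \<xi>) v + frechet_derivative F (at \<xi>) v * partial j F \<xi>))) (at \<xi>)"
      by (rule has_derivative_transform_within_open[where s="- {0}"]) (use \<xi> p1 in auto)
    from has_derivative_imp_partial[OF this, of i] show ?thesis
      by (simp add: F0 partial_def[of i F])
  qed
  have Euler: "(\<Sum>i\<in>UNIV. \<xi> $ i * partial i F \<xi>) = 0"
  proof -
    have "((\<lambda>s. \<xi> + s *\<^sub>R \<xi>) has_derivative (\<lambda>s. s *\<^sub>R \<xi>)) (at (0::real))"
      by (auto intro!: derivative_eq_intros)
    moreover have "(F has_derivative frechet_derivative F (at \<xi>)) (at (\<xi> + 0 *\<^sub>R \<xi>))"
      using differentiable_imp_has_derivative_frechet[OF d1(1)[OF \<xi>]] by simp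
    ultimately have "((\<lambda>s. F (\<xi> + s *\<^sub>R \<xi>)) has_derivative (\<lambda>s. frechet_derivative F (at \<xi>) (s *\<^sub>R \<xi>))) (at 0)"
      by (rule has_derivative_compose)
    then have "((\<lambda>s::real. 0::real) has_derivative (\<lambda>s. frechet_derivative F (at \<xi>) (s *\<^sub>R \<xi>))) (at 0)"
    \<comment> \<open>On this interval 1 + s is positive, so homogeneity applies and F is 0 along
      the ray through \<xi>.\<close>
    proof (rule has_derivative_transform_within_open[where s="{-1<..<1}"])
      fix s :: real assume "s \<in> {-1<..<1}"
      then have "F ((1 + s) *\<^sub>R \<xi>) = 0" using hom[of "1 + s" \<xi>] F0 by simp
      then show "F (\<xi> + s *\<^sub>R \<xi>) = 0" by (simp add: scaleR_add_left)
    qed auto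
    then have "(\<lambda>s. frechet_derivative F (at \<xi>) (s *\<^sub>R \<xi>)) = (\<lambda>s. 0)"
      using has_derivative_const by (rule has_derivative_unique)
    then have "frechet_derivative F (at \<xi>) (1 *\<^sub>R \<xi>) = 0" by (rule fun_cong)
    then show ?thesis using frechet_derivative_eq_sum_partial[OF d1(1)[OF \<xi>], of \<xi>] by simp
  qed
  have "\<xi> \<bullet> (hessian ?f \<xi> *v \<xi>) = (\<Sum>i\<in>UNIV. \<xi> $ i * (\<Sum>j\<in>UNIV. 2 * (partial i F \<xi> * partial j F \<xi>) * \<xi> $ j))"
    by (simp add: inner_vec_def matrix_vector_mult_def hessian_def p2)
  also have "\<dots> = (\<Sum>i\<in>UNIV. 2 * (\<xi> $ i * partial i F \<xi>) * (\<Sum>j\<in>UNIV. \<xi> $ j * partial j F \<xi>))"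
    by (simp add: sum_distrib_left mult_ac)
  also have "\<dots> = 0" by (simp add: Euler)
  finally have "\<xi> \<bullet> (hessian ?f \<xi> *v \<xi>) = 0" .
  moreover have "positive_definite (hessian ?f \<xi>)"
    using F \<xi> unfolding strongly_convex_finsler_norm_def by blast
  ultimately show False using \<xi> unfolding positive_definite_def by (metis less_irrefl)
qed

text \<open>The constant is the minimum of F on the unit sphere, positive by compactness and
  \<open>finsler_norm_pos\<close>; homogeneity carries the bound to all other nonzero
  vectors.\<close>

lemma finsler_norm_lower_bound:
  fixes F :: "real^'n::finite \<Rightarrow> real"
  assumes F: "strongly_convex_finsler_norm F"
  obtains c where "c > 0" "\<And>\<xi>. c * norm \<xi> \<le> F \<xi>"
proof -
  have "continuous_on (sphere 0 1) F"
  proof (intro continuous_at_imp_continuous_on ballI differentiable_imp_continuous_within)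
    fix x :: "real^'n" assume "x \<in> sphere 0 1"
    then have "x \<noteq> 0" by auto
    then show "F differentiable at x"
      using finsler_normD(4)[OF F] by (auto simp: numeral_2_eq_2)
  qed
  \<comment> \<open>Any coordinate vector shows that the sphere is nonempty;
    \<open>undefined\<close> stands for an arbitrary index.\<close>
  moreover have "(axis undefined 1 :: real^'n) \<in> sphere 0 1" by simp
  ultimately obtain z where z: "z \<in> sphere 0 1" "\<And>y. y \<in> sphere 0 1 \<Longrightarrow> F z \<le> F y"
    using continuous_attains_inf[of "sphere 0 1" F] by (metis compact_sphere empty_iff)
  have "z \<noteq> 0" using z(1) by auto
  then have "F z > 0" by (rule finsler_norm_pos[OF F])
  moreover have "F z * norm \<xi> \<le> F \<xi>" for \<xi>
  proof (cases "\<xi> = 0")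
    case True
    then show ?thesis using finsler_normD(1)[OF F, of 0] by simp
  next
    case False
    then have "F z \<le> F (\<xi> /\<^sub>R norm \<xi>)" by (intro z(2)) simp
    also have "F (\<xi> /\<^sub>R norm \<xi>) = F \<xi> / norm \<xi>"
      using finsler_normD(3)[OF F, of "inverse (norm \<xi>)" \<xi>] False by (simp add: divide_inverse mult.commute)
    finally show ?thesis using False by (simp add: field_simps)
  qed
  ultimately show ?thesis by (rule that)
qed

text \<open>The Cauchy-Schwarz inequality and the lower bound on F show that the real supremum in
  \<open>polar\<close> is taken over a bounded set. For nonnegativity, evenness of F makes the
  quotients at e and -e opposite numbers, and the polar is above both.\<close>

lemma polar_bounds:
  fixes F :: "real^'n::finite \<Rightarrow> real"
  assumes F: "strongly_convex_finsler_norm F"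
  obtains c where "\<And>x. 0 \<le> polar F x" "\<And>x. polar F x \<le> c * norm x" "c > 0"
proof -
  obtain c where c: "c > 0" "\<And>\<xi>. c * norm \<xi> \<le> F \<xi>" by (rule finsler_norm_lower_bound[OF F]) (rule that)
  have le: "(\<xi> \<bullet> x) / F \<xi> \<le> inverse c * norm x" if "\<xi> \<in> - {0}" for \<xi> x
  proof -
    have pos: "0 < c * norm \<xi>" using that c by simp
    have "(\<xi> \<bullet> x) / F \<xi> \<le> (norm \<xi> * norm x) / F \<xi>"
      using norm_cauchy_schwarz[of \<xi> x] pos c(2)[of \<xi>] by (intro divide_right_mono) auto
    also have "\<dots> \<le> (norm \<xi> * norm x) / (c * norm \<xi>)"
      using pos c(2)[of \<xi>] by (intro divide_left_mono) auto
    also have "\<dots> = inverse c * norm x" using that c(1) by (simp add: field_simps)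
    finally show ?thesis .
  qed
  have bdd: "bdd_above ((\<lambda>\<xi>. (\<xi> \<bullet> x) / F \<xi>) ` (- {0}))" for x by (rule bdd_aboveI2) (rule le)
  have "0 \<le> polar F x" for x
  proof -
    let ?e = "axis undefined 1 :: real^'n"
    have e: "?e \<in> - {0}" "- ?e \<in> - {0}" by auto
    have "(?e \<bullet> x) / F ?e \<le> polar F x" "((- ?e) \<bullet> x) / F (- ?e) \<le> polar F x"
      unfolding polar_def using cSUP_upper[OF e(1) bdd] cSUP_upper[OF e(2) bdd] by auto
    moreover have "F (- ?e) = F ?e" by (rule finsler_normD(2)[OF F])
    ultimately show ?thesis by simp
  qed
  moreover have "polar F x \<le> inverse c * norm x" for x
    unfolding polar_def
  proof (rule cSUP_least)
    have "(axis undefined 1 :: real^'n) \<in> - {0}" by simp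
    then show "- {0 :: real^'n} \<noteq> {}" by blast
  qed (rule le)
  moreover have "inverse c > 0" using c(1) by simp
  ultimately show ?thesis by (rule that)
qed

lemma polar_le_R_dom:
  fixes F :: "real^'n::finite \<Rightarrow> real"
  assumes F: "strongly_convex_finsler_norm F" and \<Omega>: "bounded \<Omega>" "x \<in> \<Omega>"
  shows "polar F x \<le> R_dom F \<Omega>"
proof -
  obtain c where c: "\<And>x. 0 \<le> polar F x" "\<And>x. polar F x \<le> c * norm x" "c > 0"
    by (rule polar_bounds[OF F]) (rule that)
  obtain B where "\<And>x. x \<in> \<Omega> \<Longrightarrow> norm x \<le> B" using \<Omega>(1) by (auto simp: bounded_iff)
  then have "c * norm x \<le> c * B" if "x \<in> \<Omega>" for x
    using c(3) that by simp
  then have "polar F x \<le> c * B" if "x \<in> \<Omega>" for x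
    by (rule order_trans[OF c(2)]) (use that in auto)
  then have "bdd_above (polar F ` \<Omega>)" by (rule bdd_aboveI2)
  then show ?thesis unfolding R_dom_def by (rule cSUP_upper[OF \<Omega>(2)])
qed

lemma X1_bounds:
  assumes "0 \<le> t" "t \<le> 1"
  shows "0 \<le> X1 t" "X1 t \<le> 1"
proof -
  have "ln t \<le> 0" if "t \<noteq> 0" using assms that by simp
  then show "0 \<le> X1 t" "X1 t \<le> 1" by (auto simp: X1_def)
qed

lemma X2_bounds:
  assumes "0 \<le> t" "t \<le> 1"
  shows "0 \<le> X2 t" "X2 t \<le> 1"
  using assms unfolding X2_def by (auto intro: X1_bounds)

theorem theorem3p4:
  fixes F :: "real^'n::finite \<Rightarrow> real"
    and \<Omega> :: "(real^'n) set"
    and u :: "real^'n \<Rightarrow> real"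
  assumes "CARD('n) \<ge> 2"
    and "strongly_convex_finsler_norm F"
    and "open \<Omega>" and "connected \<Omega>" and "bounded \<Omega>" and "0 \<in> \<Omega>"
    and "u \<in> sobolev0 (real CARD('n)) \<Omega>"
    and "finsler_radial_on F \<Omega> u"
    and "\<not> (AE x in lebesgue_on \<Omega>. u x = 0)"
  shows "(\<integral>\<^sup>+ x. ennreal (exp (gamma_bar F \<Omega> u *
            (\<bar>u x\<bar> * X2 (polar F x / R_dom F \<Omega>) powr (1 / real CARD('n)))
              powr (real CARD('n) / (real CARD('n) - 1))))
          \<partial>lebesgue_on \<Omega>) < \<infinity>"
proof -
  \<comment> \<open>the weight is at most 1 and the factor is a fixed real number, so its value is immaterial\<close>
  let ?n = "real CARD('n)" and ?\<gamma> = "\<bar>gamma_bar F \<Omega> u\<bar>"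
  have "(\<integral>\<^sup>+ x. ennreal (exp (gamma_bar F \<Omega> u *
            (\<bar>u x\<bar> * X2 (polar F x / R_dom F \<Omega>) powr (1 / ?n)) powr (?n / (?n - 1)))) \<partial>lebesgue_on \<Omega>)
      \<le> (\<integral>\<^sup>+ x. ennreal (exp (?\<gamma> * \<bar>u x\<bar> powr (?n / (?n - 1)))) \<partial>lebesgue_on \<Omega>)"
  proof (intro nn_integral_mono ennreal_leI, simp only: exp_le_cancel_iff)
    fix x assume "x \<in> space (lebesgue_on \<Omega>)"
    then have x: "x \<in> \<Omega>" by (simp add: space_restrict_space)
    have p: "0 \<le> polar F x" by (rule polar_bounds[OF assms(2)])
    have le: "polar F x \<le> R_dom F \<Omega>" by (rule polar_le_R_dom[OF assms(2,5) x])
    \<comment> \<open>Division by 0 has the value 0, so the quotient lies in [0, 1] for every value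
      of \<open>R_dom F \<Omega>\<close> above \<open>polar F x\<close>.\<close>
    have X: "0 \<le> X2 (polar F x / R_dom F \<Omega>)" "X2 (polar F x / R_dom F \<Omega>) \<le> 1"
      using p le by (auto intro!: X2_bounds divide_le_eq_1[THEN iffD2] divide_nonneg_nonneg)
    have "X2 (polar F x / R_dom F \<Omega>) powr (1 / ?n) \<le> 1 powr (1 / ?n)"
      using X by (intro powr_mono2) auto
    then have "\<bar>u x\<bar> * X2 (polar F x / R_dom F \<Omega>) powr (1 / ?n) \<le> \<bar>u x\<bar>"
      by (simp add: mult_left_le)
    then have "(\<bar>u x\<bar> * X2 (polar F x / R_dom F \<Omega>) powr (1 / ?n)) powr (?n / (?n - 1)) \<le> \<bar>u x\<bar> powr (?n / (?n - 1))"
      using assms(1) by (intro powr_mono2) auto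
    \<comment> \<open>Passing to the absolute value gives a nonnegative coefficient, as needed both
      for this monotonicity and for \<open>sobolev0_exp_integrable\<close>.\<close>
    then show "gamma_bar F \<Omega> u * (\<bar>u x\<bar> * X2 (polar F x / R_dom F \<Omega>) powr (1 / ?n)) powr (?n / (?n - 1))
       \<le> ?\<gamma> * \<bar>u x\<bar> powr (?n / (?n - 1))"
      by (intro mult_mono) auto
  qed
  also have "\<dots> < \<infinity>"
    by (rule sobolev0_exp_integrable[OF assms(1,3,5,7)]) simp
  finally show ?thesis .
qed

end
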